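(* The functor $\mathrm{2Spec}({}^{\Box}\mathrm{Set}):\mathrm{Gpd}\to\mathrm{2AfSch}$, $G\mapsto\mathrm{2Spec}({}^G\mathrm{Set})$, does not preserve infinite products.
   Context: Presentable category: a locally small cocomplete category that is the closure under small colimits of a small set of little objects ($x$ is little if, for some cardinal $\kappa$, $\mathrm{Hom}(x,-)$ preserves $\kappa$-directed colimits). A commutative 2-ring is a presentable symmetric monoidal category whose tensor product preserves small colimits in each variable; 1-morphisms are cocontinuous (strong) symmetric monoidal functors and 2-morphisms are monoidal natural transformations; these form the 2-category $\mathrm{Com2Ring}$. $\mathrm{2AfSch}$ is its 1-opposite and $\mathrm{2Spec}(A)$ is the object corresponding to $A$. $\mathrm{Gpd}$ is the 2-category of small groupoids. ${}^G\mathrm{Set}=\mathrm{Fun}(G,\mathrm{Set})$ is a commutative 2-ring with $\otimes=\times$; a functor $f:G\to H$ induces the 1-morphism $f^*:{}^H\mathrm{Set}\to{}^G\mathrm{Set}$. Products in 2-categories are taken in the bicategorical sense (defined up to equivalence). *)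

theory Defs
  imports "HOL-Library.Equipollence" "HOL-Library.FuncSet"
begin

section \<open>Universe\<close>

text \<open>
  Size is measured against a type \<^typ>\<open>'u\<close> whose cardinality is assumed to be an uncountable
  strongly inaccessible cardinal: a set of any type is small if it is strictly smaller than
  \<^typ>\<open>'u\<close>. Every small set is then in bijection with a subset of \<^typ>\<open>'u\<close>, so
  the small subsets of \<^typ>\<open>'u\<close> are a model of the category of small sets.
\<close>

definition inaccessible :: "'u itself \<Rightarrow> bool" where
  "inaccessible U \<longleftrightarrow>
     (UNIV :: nat set) \<prec> (UNIV :: 'u set) \<and>
     (\<forall>X :: 'u set. X \<prec> (UNIV :: 'u set) \<longrightarrow> Pow X \<prec> (UNIV :: 'u set)) \<and>
     (\<forall>(I :: 'u set) (X :: 'u \<Rightarrow> 'u set).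
        I \<prec> (UNIV :: 'u set) \<and> (\<forall>i\<in>I. X i \<prec> (UNIV :: 'u set)) \<longrightarrow>
        (\<Union>i\<in>I. X i) \<prec> (UNIV :: 'u set))"

definition small :: "'u itself \<Rightarrow> 'x set \<Rightarrow> bool" where
  "small U X \<longleftrightarrow> X \<prec> (UNIV :: 'u set)"


section \<open>Categories, functors, natural transformations\<close>

text \<open>Composition is written in applicative order: \<open>Comp C g f\<close> is \<open>f\<close> followed by \<open>g\<close>.\<close>

record ('o, 'a) cat =
  Obj :: "'o set"
  Arr :: "'a set"
  Dom :: "'a \<Rightarrow> 'o"
  Cod :: "'a \<Rightarrow> 'o"
  Idt :: "'o \<Rightarrow> 'a"
  Comp :: "'a \<Rightarrow> 'a \<Rightarrow> 'a"

definition Hom :: "('o, 'a, 'z) cat_scheme \<Rightarrow> 'o \<Rightarrow> 'o \<Rightarrow> 'a set" where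
  "Hom C x y = {f \<in> Arr C. Dom C f = x \<and> Cod C f = y}"

definition category :: "('o, 'a, 'z) cat_scheme \<Rightarrow> bool" where
  "category C \<longleftrightarrow>
     (\<forall>f\<in>Arr C. Dom C f \<in> Obj C \<and> Cod C f \<in> Obj C) \<and>
     (\<forall>x\<in>Obj C. Idt C x \<in> Hom C x x) \<and>
     (\<forall>f\<in>Arr C. \<forall>g\<in>Arr C. Cod C f = Dom C g \<longrightarrow> Comp C g f \<in> Hom C (Dom C f) (Cod C g)) \<and>
     (\<forall>f\<in>Arr C. Comp C f (Idt C (Dom C f)) = f \<and> Comp C (Idt C (Cod C f)) f = f) \<and>
     (\<forall>f\<in>Arr C. \<forall>g\<in>Arr C. \<forall>h\<in>Arr C. Cod C f = Dom C g \<and> Cod C g = Dom C h \<longrightarrow>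
        Comp C h (Comp C g f) = Comp C (Comp C h g) f)"

definition is_iso :: "('o, 'a, 'z) cat_scheme \<Rightarrow> 'a \<Rightarrow> bool" where
  "is_iso C f \<longleftrightarrow> f \<in> Arr C \<and>
     (\<exists>g\<in>Hom C (Cod C f) (Dom C f). Comp C g f = Idt C (Dom C f) \<and> Comp C f g = Idt C (Cod C f))"

definition locally_small :: "'u itself \<Rightarrow> ('o, 'a, 'z) cat_scheme \<Rightarrow> bool" where
  "locally_small U C \<longleftrightarrow> (\<forall>x\<in>Obj C. \<forall>y\<in>Obj C. small U (Hom C x y))"

definition small_category :: "'u itself \<Rightarrow> ('o, 'a, 'z) cat_scheme \<Rightarrow> bool" where
  "small_category U C \<longleftrightarrow> category C \<and> small U (Obj C) \<and> small U (Arr C)"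

text \<open>
  Functors and natural transformations are extensional functions (they take the value
  \<^const>\<open>undefined\<close> off their domain), so that equality is the intended one.
\<close>

record ('o, 'a, 'p, 'b) func =
  FObj :: "'o \<Rightarrow> 'p"
  FArr :: "'a \<Rightarrow> 'b"

definition is_functor ::
  "('o, 'a, 'x) cat_scheme \<Rightarrow> ('p, 'b, 'y) cat_scheme \<Rightarrow> ('o, 'a, 'p, 'b, 'z) func_scheme \<Rightarrow> bool" where
  "is_functor C D F \<longleftrightarrow>
     FObj F \<in> Obj C \<rightarrow>\<^sub>E Obj D \<and> FArr F \<in> extensional (Arr C) \<and>
     (\<forall>f\<in>Arr C. FArr F f \<in> Hom D (FObj F (Dom C f)) (FObj F (Cod C f))) \<and>
     (\<forall>x\<in>Obj C. FArr F (Idt C x) = Idt D (FObj F x)) \<and>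
     (\<forall>f\<in>Arr C. \<forall>g\<in>Arr C. Cod C f = Dom C g \<longrightarrow>
        FArr F (Comp C g f) = Comp D (FArr F g) (FArr F f))"

definition id_func :: "('o, 'a, 'x) cat_scheme \<Rightarrow> ('o, 'a, 'o, 'a) func" where
  "id_func C = \<lparr>FObj = (\<lambda>x\<in>Obj C. x), FArr = (\<lambda>f\<in>Arr C. f)\<rparr>"

definition comp_func ::
  "('o, 'a, 'x) cat_scheme \<Rightarrow> ('p, 'b, 'q, 'c, 'y) func_scheme \<Rightarrow> ('o, 'a, 'p, 'b, 'z) func_scheme
    \<Rightarrow> ('o, 'a, 'q, 'c) func" where
  "comp_func C G F =
     \<lparr>FObj = compose (Obj C) (FObj G) (FObj F), FArr = compose (Arr C) (FArr G) (FArr F)\<rparr>"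

definition nat_trans ::
  "('o, 'a, 'x) cat_scheme \<Rightarrow> ('p, 'b, 'y) cat_scheme \<Rightarrow> ('o, 'a, 'p, 'b, 'z) func_scheme
    \<Rightarrow> ('o, 'a, 'p, 'b, 'w) func_scheme \<Rightarrow> ('o \<Rightarrow> 'b) \<Rightarrow> bool" where
  "nat_trans C D F G \<eta> \<longleftrightarrow>
     \<eta> \<in> extensional (Obj C) \<and>
     (\<forall>x\<in>Obj C. \<eta> x \<in> Hom D (FObj F x) (FObj G x)) \<and>
     (\<forall>f\<in>Arr C. Comp D (\<eta> (Cod C f)) (FArr F f) = Comp D (FArr G f) (\<eta> (Dom C f)))"

definition nat_isomorphic ::
  "('o, 'a, 'x) cat_scheme \<Rightarrow> ('p, 'b, 'y) cat_scheme \<Rightarrow> ('o, 'a, 'p, 'b, 'z) func_scheme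
    \<Rightarrow> ('o, 'a, 'p, 'b, 'w) func_scheme \<Rightarrow> bool" where
  "nat_isomorphic C D F G \<longleftrightarrow> (\<exists>\<eta>. nat_trans C D F G \<eta> \<and> (\<forall>x\<in>Obj C. is_iso D (\<eta> x)))"

definition is_equivalence ::
  "('o, 'a, 'x) cat_scheme \<Rightarrow> ('p, 'b, 'y) cat_scheme \<Rightarrow> ('o, 'a, 'p, 'b) func \<Rightarrow> bool" where
  "is_equivalence C D F \<longleftrightarrow> is_functor C D F \<and>
     (\<exists>G :: ('p, 'b, 'o, 'a) func. is_functor D C G \<and>
        nat_isomorphic C C (id_func C) (comp_func C G F) \<and>
        nat_isomorphic D D (comp_func D F G) (id_func D))"

text \<open>
  An arrow that remembers its source and target, used for maps of sets and for
  (monoidal) natural transformations.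
\<close>

datatype ('p, 'm) arrow = Arrow (source: 'p) (target: 'p) (under: 'm)

definition vcomp ::
  "('o, 'a, 'x) cat_scheme \<Rightarrow> ('p, 'b, 'y) cat_scheme \<Rightarrow> ('f, 'o \<Rightarrow> 'b) arrow
    \<Rightarrow> ('f, 'o \<Rightarrow> 'b) arrow \<Rightarrow> ('f, 'o \<Rightarrow> 'b) arrow" where
  "vcomp C D \<beta> \<alpha> =
     Arrow (source \<alpha>) (target \<beta>) (\<lambda>x\<in>Obj C. Comp D (under \<beta> x) (under \<alpha> x))"

definition idt_trans ::
  "('o, 'a, 'x) cat_scheme \<Rightarrow> ('p, 'b, 'y) cat_scheme \<Rightarrow> ('o, 'a, 'p, 'b, 'z) func_scheme
    \<Rightarrow> (('o, 'a, 'p, 'b, 'z) func_scheme, 'o \<Rightarrow> 'b) arrow" where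
  "idt_trans C D F = Arrow F F (\<lambda>x\<in>Obj C. Idt D (FObj F x))"

text \<open>
  Horizontal composite of \<open>\<alpha> : F \<Rightarrow> F' : C \<rightarrow> D\<close> and \<open>\<beta> : G \<Rightarrow> G' : D \<rightarrow> E\<close>; the argument
  \<open>cmp\<close> is the composition of 1-cells.
\<close>

definition hcomp ::
  "('o, 'a, 'x) cat_scheme \<Rightarrow> ('q, 'c, 'y) cat_scheme \<Rightarrow>
    (('p, 'b, 'q, 'c, 'z) func_scheme \<Rightarrow> ('o, 'a, 'p, 'b, 'w) func_scheme \<Rightarrow> 'h) \<Rightarrow>
    (('p, 'b, 'q, 'c, 'z) func_scheme, 'p \<Rightarrow> 'c) arrow \<Rightarrow>
    (('o, 'a, 'p, 'b, 'w) func_scheme, 'o \<Rightarrow> 'b) arrow \<Rightarrow> ('h, 'o \<Rightarrow> 'c) arrow" where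
  "hcomp C E cmp \<beta> \<alpha> =
     Arrow (cmp (source \<beta>) (source \<alpha>)) (cmp (target \<beta>) (target \<alpha>))
       (\<lambda>x\<in>Obj C. Comp E (under \<beta> (FObj (target \<alpha>) x)) (FArr (source \<beta>) (under \<alpha> x)))"

definition fun_cat ::
  "('o, 'a, 'x) cat_scheme \<Rightarrow> ('p, 'b, 'y) cat_scheme
    \<Rightarrow> (('o, 'a, 'p, 'b) func, (('o, 'a, 'p, 'b) func, 'o \<Rightarrow> 'b) arrow) cat" where
  "fun_cat C D =
     \<lparr>Obj = {F. is_functor C D F},
      Arr = {Arrow F G \<eta> | F G \<eta>. is_functor C D F \<and> is_functor C D G \<and> nat_trans C D F G \<eta>},
      Dom = source, Cod = target,
      Idt = idt_trans C D, Comp = vcomp C D\<rparr>"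

definition prod_cat :: "'i set \<Rightarrow> ('i \<Rightarrow> ('o, 'a, 'x) cat_scheme) \<Rightarrow> ('i \<Rightarrow> 'o, 'i \<Rightarrow> 'a) cat" where
  "prod_cat I C =
     \<lparr>Obj = (\<Pi>\<^sub>E i\<in>I. Obj (C i)),
      Arr = (\<Pi>\<^sub>E i\<in>I. Arr (C i)),
      Dom = (\<lambda>f. \<lambda>i\<in>I. Dom (C i) (f i)), Cod = (\<lambda>f. \<lambda>i\<in>I. Cod (C i) (f i)),
      Idt = (\<lambda>x. \<lambda>i\<in>I. Idt (C i) (x i)), Comp = (\<lambda>g f. \<lambda>i\<in>I. Comp (C i) (g i) (f i))\<rparr>"


section \<open>Small sets and colimits\<close>

definition set_map :: "'x set \<Rightarrow> 'x set \<Rightarrow> ('x \<Rightarrow> 'x) \<Rightarrow> ('x set, 'x \<Rightarrow> 'x) arrow" where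
  "set_map X Y f = Arrow X Y (restrict f X)"

text \<open>
  Small sets with elements in an arbitrary type \<^typ>\<open>'x\<close>. For \<^typ>\<open>'x\<close> at least as large as
  \<^typ>\<open>'u\<close> this is equivalent to the category of small subsets of \<^typ>\<open>'u\<close>; the extra
  generality allows hom-functors to take values in it without re-encoding.
\<close>

definition set_cat :: "'u itself \<Rightarrow> ('x set, ('x set, 'x \<Rightarrow> 'x) arrow) cat" where
  "set_cat U =
     \<lparr>Obj = {X. small U X},
      Arr = {Arrow X Y f | X Y f. small U X \<and> small U Y \<and> f \<in> X \<rightarrow>\<^sub>E Y},
      Dom = source, Cod = target,
      Idt = (\<lambda>X. set_map X X (\<lambda>x. x)),
      Comp = (\<lambda>g f. set_map (source f) (target g) (\<lambda>x. under g (under f x)))\<rparr>"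

definition hom_func ::
  "('o, 'a, 'x) cat_scheme \<Rightarrow> 'o \<Rightarrow> ('o, 'a, 'a set, ('a set, 'a \<Rightarrow> 'a) arrow) func" where
  "hom_func C x =
     \<lparr>FObj = (\<lambda>y\<in>Obj C. Hom C x y),
      FArr = (\<lambda>f\<in>Arr C. set_map (Hom C x (Dom C f)) (Hom C x (Cod C f)) (\<lambda>g. Comp C f g))\<rparr>"

definition cocone ::
  "('j, 'k, 'x) cat_scheme \<Rightarrow> ('o, 'a, 'y) cat_scheme \<Rightarrow> ('j, 'k, 'o, 'a, 'z) func_scheme
    \<Rightarrow> 'o \<Rightarrow> ('j \<Rightarrow> 'a) \<Rightarrow> bool" where
  "cocone J C D c \<iota> \<longleftrightarrow> c \<in> Obj C \<and>
     (\<forall>j\<in>Obj J. \<iota> j \<in> Hom C (FObj D j) c) \<and>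
     (\<forall>k\<in>Arr J. Comp C (\<iota> (Cod J k)) (FArr D k) = \<iota> (Dom J k))"

definition is_colimit ::
  "('j, 'k, 'x) cat_scheme \<Rightarrow> ('o, 'a, 'y) cat_scheme \<Rightarrow> ('j, 'k, 'o, 'a, 'z) func_scheme
    \<Rightarrow> 'o \<Rightarrow> ('j \<Rightarrow> 'a) \<Rightarrow> bool" where
  "is_colimit J C D c \<iota> \<longleftrightarrow> cocone J C D c \<iota> \<and>
     (\<forall>d \<mu>. cocone J C D d \<mu> \<longrightarrow> (\<exists>!h. h \<in> Hom C c d \<and> (\<forall>j\<in>Obj J. Comp C h (\<iota> j) = \<mu> j)))"

definition preserves_colimit ::
  "('j, 'k, 'x) cat_scheme \<Rightarrow> ('j, 'k, 'o, 'a, 'v) func_scheme \<Rightarrow> ('o, 'a, 'y) cat_scheme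
    \<Rightarrow> ('p, 'b, 'z) cat_scheme \<Rightarrow> ('o, 'a, 'p, 'b, 'w) func_scheme \<Rightarrow> bool" where
  "preserves_colimit J D C E F \<longleftrightarrow>
     (\<forall>c \<iota>. is_colimit J C D c \<iota> \<longrightarrow>
        is_colimit J E (comp_func J F D) (FObj F c) (\<lambda>j. FArr F (\<iota> j)))"

text \<open>
  Index categories are taken with objects and arrows in \<^typ>\<open>'u\<close>; every small category is
  isomorphic to one of these.
\<close>

definition cocomplete :: "'u itself \<Rightarrow> ('o, 'a, 'x) cat_scheme \<Rightarrow> bool" where
  "cocomplete U C \<longleftrightarrow>
     (\<forall>(J :: ('u, 'u) cat) D. small_category U J \<and> is_functor J C (D :: ('u, 'u, 'o, 'a) func)
        \<longrightarrow> (\<exists>c \<iota>. is_colimit J C D c \<iota>))"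

definition cocontinuous ::
  "'u itself \<Rightarrow> ('o, 'a, 'x) cat_scheme \<Rightarrow> ('p, 'b, 'y) cat_scheme
    \<Rightarrow> ('o, 'a, 'p, 'b, 'z) func_scheme \<Rightarrow> bool" where
  "cocontinuous U C E F \<longleftrightarrow>
     (\<forall>(J :: ('u, 'u) cat) D. small_category U J \<and> is_functor J C (D :: ('u, 'u, 'o, 'a) func)
        \<longrightarrow> preserves_colimit J D C E F)"


section \<open>Presentable categories\<close>

definition poset_cat :: "'j set \<Rightarrow> ('j \<times> 'j) set \<Rightarrow> ('j, 'j \<times> 'j) cat" where
  "poset_cat A r =
     \<lparr>Obj = A, Arr = r, Dom = fst, Cod = snd,
      Idt = (\<lambda>x. (x, x)), Comp = (\<lambda>g f. (fst f, snd g))\<rparr>"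

text \<open>The cardinal \<open>\<kappa>\<close> is represented by a set \<open>K\<close> of that cardinality.\<close>

definition directed_poset :: "'k set \<Rightarrow> 'j set \<Rightarrow> ('j \<times> 'j) set \<Rightarrow> bool" where
  "directed_poset K A r \<longleftrightarrow> r \<subseteq> A \<times> A \<and> partial_order_on A r \<and>
     (\<forall>X. X \<subseteq> A \<and> X \<prec> K \<longrightarrow> (\<exists>u\<in>A. \<forall>x\<in>X. (x, u) \<in> r))"

text \<open>
  The cardinal has to be small: a small poset which is \<open>\<kappa>\<close>-directed for a non-small
  \<open>\<kappa>\<close> has a greatest element.
\<close>

definition little :: "'u itself \<Rightarrow> ('o, 'a, 'x) cat_scheme \<Rightarrow> 'o \<Rightarrow> bool" where
  "little U C x \<longleftrightarrow> x \<in> Obj C \<and>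
     (\<exists>K :: 'u set. small U K \<and>
        (\<forall>(A :: 'u set) r D. small U A \<and> directed_poset K A r \<and>
            is_functor (poset_cat A r) C (D :: ('u, 'u \<times> 'u, 'o, 'a) func) \<longrightarrow>
            preserves_colimit (poset_cat A r) D C (set_cat U) (hom_func C x)))"

inductive_set colimit_closure :: "'u itself \<Rightarrow> ('o, 'a, 'x) cat_scheme \<Rightarrow> 'o set \<Rightarrow> 'o set"
  for U :: "'u itself" and C :: "('o, 'a, 'x) cat_scheme" and S :: "'o set" where
  base: "x \<in> S \<Longrightarrow> x \<in> colimit_closure U C S"
| colimit: "small_category U (J :: ('u, 'u) cat) \<Longrightarrow> is_functor J C (D :: ('u, 'u, 'o, 'a) func)
    \<Longrightarrow> (\<And>j. j \<in> Obj J \<Longrightarrow> FObj D j \<in> colimit_closure U C S)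
    \<Longrightarrow> is_colimit J C D c \<iota> \<Longrightarrow> c \<in> colimit_closure U C S"

definition presentable :: "'u itself \<Rightarrow> ('o, 'a, 'x) cat_scheme \<Rightarrow> bool" where
  "presentable U C \<longleftrightarrow> category C \<and> locally_small U C \<and> cocomplete U C \<and>
     (\<exists>S. small U S \<and> (\<forall>x\<in>S. little U C x) \<and> Obj C = colimit_closure U C S)"


section \<open>Symmetric monoidal categories\<close>

text \<open>
  \<open>Assoc x y z : (x \<otimes> y) \<otimes> z \<rightarrow> x \<otimes> (y \<otimes> z)\<close>, \<open>LUnit x : 1 \<otimes> x \<rightarrow> x\<close>,
  \<open>RUnit x : x \<otimes> 1 \<rightarrow> x\<close>, \<open>Braid x y : x \<otimes> y \<rightarrow> y \<otimes> x\<close>.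
\<close>

record ('o, 'a) moncat = "('o, 'a) cat" +
  TensO :: "'o \<Rightarrow> 'o \<Rightarrow> 'o"
  TensA :: "'a \<Rightarrow> 'a \<Rightarrow> 'a"
  Unit :: 'o
  Assoc :: "'o \<Rightarrow> 'o \<Rightarrow> 'o \<Rightarrow> 'a"
  LUnit :: "'o \<Rightarrow> 'a"
  RUnit :: "'o \<Rightarrow> 'a"
  Braid :: "'o \<Rightarrow> 'o \<Rightarrow> 'a"

definition tensor_bifunctor :: "('o, 'a, 'x) moncat_scheme \<Rightarrow> bool" where
  "tensor_bifunctor M \<longleftrightarrow>
     (\<forall>x\<in>Obj M. \<forall>y\<in>Obj M. TensO M x y \<in> Obj M \<and>
        TensA M (Idt M x) (Idt M y) = Idt M (TensO M x y)) \<and>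
     (\<forall>f\<in>Arr M. \<forall>g\<in>Arr M.
        TensA M f g \<in> Hom M (TensO M (Dom M f) (Dom M g)) (TensO M (Cod M f) (Cod M g))) \<and>
     (\<forall>f\<in>Arr M. \<forall>f'\<in>Arr M. \<forall>g\<in>Arr M. \<forall>g'\<in>Arr M.
        Cod M f = Dom M f' \<and> Cod M g = Dom M g' \<longrightarrow>
        TensA M (Comp M f' f) (Comp M g' g) = Comp M (TensA M f' g') (TensA M f g))"

definition constraints_natural :: "('o, 'a, 'x) moncat_scheme \<Rightarrow> bool" where
  "constraints_natural M \<longleftrightarrow>
     (\<forall>x\<in>Obj M. \<forall>y\<in>Obj M. \<forall>z\<in>Obj M. is_iso M (Assoc M x y z) \<and>
        Assoc M x y z \<in> Hom M (TensO M (TensO M x y) z) (TensO M x (TensO M y z))) \<and>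
     (\<forall>x\<in>Obj M. is_iso M (LUnit M x) \<and> LUnit M x \<in> Hom M (TensO M (Unit M) x) x) \<and>
     (\<forall>x\<in>Obj M. is_iso M (RUnit M x) \<and> RUnit M x \<in> Hom M (TensO M x (Unit M)) x) \<and>
     (\<forall>x\<in>Obj M. \<forall>y\<in>Obj M. Braid M x y \<in> Hom M (TensO M x y) (TensO M y x)) \<and>
     (\<forall>f\<in>Arr M. \<forall>g\<in>Arr M. \<forall>h\<in>Arr M.
        Comp M (Assoc M (Cod M f) (Cod M g) (Cod M h)) (TensA M (TensA M f g) h) =
        Comp M (TensA M f (TensA M g h)) (Assoc M (Dom M f) (Dom M g) (Dom M h))) \<and>
     (\<forall>f\<in>Arr M. Comp M (LUnit M (Cod M f)) (TensA M (Idt M (Unit M)) f) =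
        Comp M f (LUnit M (Dom M f))) \<and>
     (\<forall>f\<in>Arr M. Comp M (RUnit M (Cod M f)) (TensA M f (Idt M (Unit M))) =
        Comp M f (RUnit M (Dom M f))) \<and>
     (\<forall>f\<in>Arr M. \<forall>g\<in>Arr M.
        Comp M (Braid M (Cod M f) (Cod M g)) (TensA M f g) =
        Comp M (TensA M g f) (Braid M (Dom M f) (Dom M g)))"

text \<open>Triangle, pentagon, symmetry and hexagon.\<close>

definition constraints_coherent :: "('o, 'a, 'x) moncat_scheme \<Rightarrow> bool" where
  "constraints_coherent M \<longleftrightarrow>
     (\<forall>x\<in>Obj M. \<forall>y\<in>Obj M.
        Comp M (TensA M (Idt M x) (LUnit M y)) (Assoc M x (Unit M) y) =
        TensA M (RUnit M x) (Idt M y)) \<and>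
     (\<forall>w\<in>Obj M. \<forall>x\<in>Obj M. \<forall>y\<in>Obj M. \<forall>z\<in>Obj M.
        Comp M (Assoc M w x (TensO M y z)) (Assoc M (TensO M w x) y z) =
        Comp M (TensA M (Idt M w) (Assoc M x y z))
          (Comp M (Assoc M w (TensO M x y) z) (TensA M (Assoc M w x y) (Idt M z)))) \<and>
     (\<forall>x\<in>Obj M. \<forall>y\<in>Obj M. Comp M (Braid M y x) (Braid M x y) = Idt M (TensO M x y)) \<and>
     (\<forall>x\<in>Obj M. \<forall>y\<in>Obj M. \<forall>z\<in>Obj M.
        Comp M (Assoc M y z x) (Comp M (Braid M x (TensO M y z)) (Assoc M x y z)) =
        Comp M (TensA M (Idt M y) (Braid M x z))
          (Comp M (Assoc M y x z) (TensA M (Braid M x y) (Idt M z))))"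

definition symmetric_monoidal :: "('o, 'a, 'x) moncat_scheme \<Rightarrow> bool" where
  "symmetric_monoidal M \<longleftrightarrow> category M \<and> Unit M \<in> Obj M \<and>
     tensor_bifunctor M \<and> constraints_natural M \<and> constraints_coherent M"

text \<open>\<open>MuF (x, y) : F x \<otimes> F y \<rightarrow> F (x \<otimes> y)\<close> and \<open>EpsF : 1 \<rightarrow> F 1\<close>.\<close>

record ('o, 'a, 'p, 'b) monfunc = "('o, 'a, 'p, 'b) func" +
  MuF :: "'o \<times> 'o \<Rightarrow> 'b"
  EpsF :: 'b

definition symmetric_monoidal_functor ::
  "('o, 'a, 'x) moncat_scheme \<Rightarrow> ('p, 'b, 'y) moncat_scheme
    \<Rightarrow> ('o, 'a, 'p, 'b, 'z) monfunc_scheme \<Rightarrow> bool" where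
  "symmetric_monoidal_functor M N F \<longleftrightarrow> is_functor M N F \<and>
     MuF F \<in> extensional (Obj M \<times> Obj M) \<and>
     is_iso N (EpsF F) \<and> EpsF F \<in> Hom N (Unit N) (FObj F (Unit M)) \<and>
     (\<forall>x\<in>Obj M. \<forall>y\<in>Obj M. is_iso N (MuF F (x, y)) \<and>
        MuF F (x, y) \<in> Hom N (TensO N (FObj F x) (FObj F y)) (FObj F (TensO M x y))) \<and>
     (\<forall>f\<in>Arr M. \<forall>g\<in>Arr M.
        Comp N (MuF F (Cod M f, Cod M g)) (TensA N (FArr F f) (FArr F g)) =
        Comp N (FArr F (TensA M f g)) (MuF F (Dom M f, Dom M g))) \<and>
     (\<forall>x\<in>Obj M. \<forall>y\<in>Obj M. \<forall>z\<in>Obj M.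
        Comp N (FArr F (Assoc M x y z))
          (Comp N (MuF F (TensO M x y, z)) (TensA N (MuF F (x, y)) (Idt N (FObj F z)))) =
        Comp N (MuF F (x, TensO M y z))
          (Comp N (TensA N (Idt N (FObj F x)) (MuF F (y, z)))
            (Assoc N (FObj F x) (FObj F y) (FObj F z)))) \<and>
     (\<forall>x\<in>Obj M.
        Comp N (FArr F (LUnit M x))
          (Comp N (MuF F (Unit M, x)) (TensA N (EpsF F) (Idt N (FObj F x)))) =
        LUnit N (FObj F x)) \<and>
     (\<forall>x\<in>Obj M.
        Comp N (FArr F (RUnit M x))
          (Comp N (MuF F (x, Unit M)) (TensA N (Idt N (FObj F x)) (EpsF F))) =
        RUnit N (FObj F x)) \<and>
     (\<forall>x\<in>Obj M. \<forall>y\<in>Obj M.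
        Comp N (FArr F (Braid M x y)) (MuF F (x, y)) =
        Comp N (MuF F (y, x)) (Braid N (FObj F x) (FObj F y)))"

definition id_monfunc :: "('o, 'a, 'x) moncat_scheme \<Rightarrow> ('o, 'a, 'o, 'a) monfunc" where
  "id_monfunc M =
     \<lparr>FObj = (\<lambda>x\<in>Obj M. x), FArr = (\<lambda>f\<in>Arr M. f),
      MuF = (\<lambda>(x, y)\<in>Obj M \<times> Obj M. Idt M (TensO M x y)), EpsF = Idt M (Unit M)\<rparr>"

definition comp_monfunc ::
  "('o, 'a, 'x) moncat_scheme \<Rightarrow> ('q, 'c, 'y) moncat_scheme
    \<Rightarrow> ('p, 'b, 'q, 'c) monfunc \<Rightarrow> ('o, 'a, 'p, 'b) monfunc \<Rightarrow> ('o, 'a, 'q, 'c) monfunc" where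
  "comp_monfunc M P G F =
     \<lparr>FObj = compose (Obj M) (FObj G) (FObj F), FArr = compose (Arr M) (FArr G) (FArr F),
      MuF = (\<lambda>(x, y)\<in>Obj M \<times> Obj M.
               Comp P (FArr G (MuF F (x, y))) (MuF G (FObj F x, FObj F y))),
      EpsF = Comp P (FArr G (EpsF F)) (EpsF G)\<rparr>"

definition monoidal_trans ::
  "('o, 'a, 'x) moncat_scheme \<Rightarrow> ('p, 'b, 'y) moncat_scheme
    \<Rightarrow> ('o, 'a, 'p, 'b) monfunc \<Rightarrow> ('o, 'a, 'p, 'b) monfunc \<Rightarrow> ('o \<Rightarrow> 'b) \<Rightarrow> bool" where
  "monoidal_trans M N F G \<eta> \<longleftrightarrow> nat_trans M N F G \<eta> \<and>
     (\<forall>x\<in>Obj M. \<forall>y\<in>Obj M.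
        Comp N (\<eta> (TensO M x y)) (MuF F (x, y)) =
        Comp N (MuF G (x, y)) (TensA N (\<eta> x) (\<eta> y))) \<and>
     Comp N (\<eta> (Unit M)) (EpsF F) = EpsF G"


section \<open>Strict 2-categories and bicategorical products\<close>

text \<open>
  All 2-categories involved are strict. \<open>Comp1 K x y z g f\<close> is the composite of
  \<open>f : x \<rightarrow> y\<close> and \<open>g : y \<rightarrow> z\<close>; \<open>Comp2\<close> is the horizontal composition of 2-cells.
\<close>

record ('x, 'm, 'c) two_cat =
  Ob :: "'x set"
  HomCat :: "'x \<Rightarrow> 'x \<Rightarrow> ('m, 'c) cat"
  One :: "'x \<Rightarrow> 'm"
  Comp1 :: "'x \<Rightarrow> 'x \<Rightarrow> 'x \<Rightarrow> 'm \<Rightarrow> 'm \<Rightarrow> 'm"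
  Comp2 :: "'x \<Rightarrow> 'x \<Rightarrow> 'x \<Rightarrow> 'c \<Rightarrow> 'c \<Rightarrow> 'c"

text \<open>1-cells are reversed, 2-cells are not.\<close>

definition one_op :: "('x, 'm, 'c) two_cat \<Rightarrow> ('x, 'm, 'c) two_cat" where
  "one_op K =
     \<lparr>Ob = Ob K, HomCat = (\<lambda>x y. HomCat K y x), One = One K,
      Comp1 = (\<lambda>x y z g f. Comp1 K z y x f g), Comp2 = (\<lambda>x y z \<beta> \<alpha>. Comp2 K z y x \<alpha> \<beta>)\<rparr>"

record ('x, 'm, 'c, 'y, 'n, 'd) two_func =
  TObj :: "'x \<Rightarrow> 'y"
  TCell1 :: "'x \<Rightarrow> 'x \<Rightarrow> 'm \<Rightarrow> 'n"
  TCell2 :: "'x \<Rightarrow> 'x \<Rightarrow> 'c \<Rightarrow> 'd"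

definition is_cone :: "('x, 'm, 'c) two_cat \<Rightarrow> 'i set \<Rightarrow> ('i \<Rightarrow> 'x) \<Rightarrow> 'x \<Rightarrow> ('i \<Rightarrow> 'm) \<Rightarrow> bool" where
  "is_cone K I A P \<pi> \<longleftrightarrow> P \<in> Ob K \<and> (\<forall>i\<in>I. A i \<in> Ob K \<and> \<pi> i \<in> Obj (HomCat K P (A i)))"

text \<open>The functor \<open>K(T, P) \<rightarrow> (\<Prod>i\<in>I. K(T, A i))\<close> given by composition with the \<open>\<pi> i\<close>.\<close>

definition comparison ::
  "('x, 'm, 'c) two_cat \<Rightarrow> 'i set \<Rightarrow> ('i \<Rightarrow> 'x) \<Rightarrow> 'x \<Rightarrow> ('i \<Rightarrow> 'm) \<Rightarrow> 'x
    \<Rightarrow> ('m, 'c, 'i \<Rightarrow> 'm, 'i \<Rightarrow> 'c) func" where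
  "comparison K I A P \<pi> T =
     \<lparr>FObj = (\<lambda>f\<in>Obj (HomCat K T P). \<lambda>i\<in>I. Comp1 K T P (A i) (\<pi> i) f),
      FArr = (\<lambda>\<alpha>\<in>Arr (HomCat K T P). \<lambda>i\<in>I.
                Comp2 K T P (A i) (Idt (HomCat K P (A i)) (\<pi> i)) \<alpha>)\<rparr>"

definition universal_cone ::
  "('x, 'm, 'c) two_cat \<Rightarrow> 'i set \<Rightarrow> ('i \<Rightarrow> 'x) \<Rightarrow> 'x \<Rightarrow> ('i \<Rightarrow> 'm) \<Rightarrow> bool" where
  "universal_cone K I A P \<pi> \<longleftrightarrow>
     (\<forall>T\<in>Ob K. is_equivalence (HomCat K T P) (prod_cat I (\<lambda>i. HomCat K T (A i)))
        (comparison K I A P \<pi> T))"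

definition is_product ::
  "('x, 'm, 'c) two_cat \<Rightarrow> 'i set \<Rightarrow> ('i \<Rightarrow> 'x) \<Rightarrow> 'x \<Rightarrow> ('i \<Rightarrow> 'm) \<Rightarrow> bool" where
  "is_product K I A P \<pi> \<longleftrightarrow> is_cone K I A P \<pi> \<and> universal_cone K I A P \<pi>"

text \<open>
  A 2-functor automatically sends cones to cones, so only the universal property of the image
  cone is asked for.
\<close>

definition preserves_infinite_products ::
  "'u itself \<Rightarrow> ('x, 'm, 'c) two_cat \<Rightarrow> ('y, 'n, 'd) two_cat
    \<Rightarrow> ('x, 'm, 'c, 'y, 'n, 'd) two_func \<Rightarrow> bool" where
  "preserves_infinite_products U K L \<Phi> \<longleftrightarrow>
     (\<forall>(I :: 'u set) A P \<pi>. small U I \<and> infinite I \<and> is_product K I A P \<pi> \<longrightarrow>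
        universal_cone L I (\<lambda>i. TObj \<Phi> (A i)) (TObj \<Phi> P) (\<lambda>i. TCell1 \<Phi> P (A i) (\<pi> i)))"


section \<open>The 2-categories Gpd, Com2Ring and 2AfSch\<close>

definition groupoid :: "('o, 'a, 'x) cat_scheme \<Rightarrow> bool" where
  "groupoid G \<longleftrightarrow> category G \<and> (\<forall>f\<in>Arr G. is_iso G f)"

type_synonym 'u gpd = "('u, 'u) cat"
type_synonym 'u gpd_func = "('u, 'u, 'u, 'u) func"

definition Gpd ::
  "'u itself \<Rightarrow> ('u gpd, 'u gpd_func, ('u gpd_func, 'u \<Rightarrow> 'u) arrow) two_cat" where
  "Gpd U =
     \<lparr>Ob = {G. groupoid G \<and> small_category U G},
      HomCat = fun_cat,
      One = id_func,
      Comp1 = (\<lambda>G H K. comp_func G),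
      Comp2 = (\<lambda>G H K. hcomp G K (comp_func G))\<rparr>"

definition commutative_2ring :: "'u itself \<Rightarrow> ('o, 'a) moncat \<Rightarrow> bool" where
  "commutative_2ring U R \<longleftrightarrow> presentable U R \<and> symmetric_monoidal R \<and>
     (\<forall>x\<in>Obj R.
        cocontinuous U R R \<lparr>FObj = (\<lambda>y\<in>Obj R. TensO R x y), FArr = (\<lambda>f\<in>Arr R. TensA R (Idt R x) f)\<rparr> \<and>
        cocontinuous U R R \<lparr>FObj = (\<lambda>y\<in>Obj R. TensO R y x), FArr = (\<lambda>f\<in>Arr R. TensA R f (Idt R x))\<rparr>)"

definition com2ring_hom ::
  "'u itself \<Rightarrow> ('o, 'a) moncat \<Rightarrow> ('p, 'b) moncat
    \<Rightarrow> (('o, 'a, 'p, 'b) monfunc, (('o, 'a, 'p, 'b) monfunc, 'o \<Rightarrow> 'b) arrow) cat" where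
  "com2ring_hom U R S =
     (let F1 = {F. symmetric_monoidal_functor R S F \<and> cocontinuous U R S F} in
      \<lparr>Obj = F1,
       Arr = {Arrow F G \<eta> | F G \<eta>. F \<in> F1 \<and> G \<in> F1 \<and> monoidal_trans R S F G \<eta>},
       Dom = source, Cod = target,
       Idt = idt_trans R S, Comp = vcomp R S\<rparr>)"

type_synonym ('o, 'a) ring_func = "('o, 'a, 'o, 'a) monfunc"

text \<open>
  The commutative 2-rings with objects in \<^typ>\<open>'o\<close> and arrows in \<^typ>\<open>'a\<close>. Relative to an
  inaccessible \<^typ>\<open>'u\<close>, a presentable category has at most \<^typ>\<open>'u\<close>-many objects up to
  isomorphism. So as soon as \<^typ>\<open>'o\<close> and \<^typ>\<open>'a\<close> are at least as large as \<^typ>\<open>'u\<close>, every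
  commutative 2-ring has an equivalent copy here, and enlarging the types does not change the
  2-category up to biequivalence.
\<close>

definition Com2Ring ::
  "'u itself \<Rightarrow>
    (('o, 'a) moncat, ('o, 'a) ring_func, (('o, 'a) ring_func, 'o \<Rightarrow> 'a) arrow) two_cat" where
  "Com2Ring U =
     \<lparr>Ob = {R. commutative_2ring U R},
      HomCat = com2ring_hom U,
      One = id_monfunc,
      Comp1 = (\<lambda>R S T. comp_monfunc R T),
      Comp2 = (\<lambda>R S T. hcomp R T (comp_monfunc R T))\<rparr>"

text \<open>An object of \<open>TwoAfSch\<close> is a commutative 2-ring \<open>A\<close>, read as \<open>2Spec A\<close>.\<close>

definition TwoAfSch ::
  "'u itself \<Rightarrow>
    (('o, 'a) moncat, ('o, 'a) ring_func, (('o, 'a) ring_func, 'o \<Rightarrow> 'a) arrow) two_cat" where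
  "TwoAfSch U = one_op (Com2Ring U)"


section \<open>Sets with a groupoid action\<close>

text \<open>Cartesian products of subsets of \<^typ>\<open>'u\<close> are formed through a chosen pairing.\<close>

definition upair :: "'u \<times> 'u \<Rightarrow> 'u" where
  "upair = (SOME p. inj p)"

definition ufst :: "'u \<Rightarrow> 'u" where
  "ufst z = fst (inv upair z)"

definition usnd :: "'u \<Rightarrow> 'u" where
  "usnd z = snd (inv upair z)"

definition utimes :: "'u set \<Rightarrow> 'u set \<Rightarrow> 'u set" where
  "utimes X Y = upair ` (X \<times> Y)"

definition upoint :: "'u set" where
  "upoint = {undefined}"

definition Set_moncat :: "'u itself \<Rightarrow> ('u set, ('u set, 'u \<Rightarrow> 'u) arrow) moncat" where
  "Set_moncat U =
     \<lparr>Obj = Obj (set_cat U), Arr = Arr (set_cat U), Dom = Dom (set_cat U), Cod = Cod (set_cat U),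
      Idt = Idt (set_cat U), Comp = Comp (set_cat U),
      TensO = utimes,
      TensA = (\<lambda>f g. set_map (utimes (source f) (source g)) (utimes (target f) (target g))
                 (\<lambda>z. upair (under f (ufst z), under g (usnd z)))),
      Unit = upoint,
      Assoc = (\<lambda>X Y Z. set_map (utimes (utimes X Y) Z) (utimes X (utimes Y Z))
                 (\<lambda>t. upair (ufst (ufst t), upair (usnd (ufst t), usnd t)))),
      LUnit = (\<lambda>X. set_map (utimes upoint X) X usnd),
      RUnit = (\<lambda>X. set_map (utimes X upoint) X ufst),
      Braid = (\<lambda>X Y. set_map (utimes X Y) (utimes Y X) (\<lambda>z. upair (usnd z, ufst z)))\<rparr>"

text \<open>The pointwise symmetric monoidal structure on a functor category.\<close>

definition tensor_func ::
  "('o, 'a, 'x) cat_scheme \<Rightarrow> ('p, 'b, 'y) moncat_scheme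
    \<Rightarrow> ('o, 'a, 'p, 'b) func \<Rightarrow> ('o, 'a, 'p, 'b) func \<Rightarrow> ('o, 'a, 'p, 'b) func" where
  "tensor_func J M F G =
     \<lparr>FObj = (\<lambda>x\<in>Obj J. TensO M (FObj F x) (FObj G x)),
      FArr = (\<lambda>f\<in>Arr J. TensA M (FArr F f) (FArr G f))\<rparr>"

definition unit_func ::
  "('o, 'a, 'x) cat_scheme \<Rightarrow> ('p, 'b, 'y) moncat_scheme \<Rightarrow> ('o, 'a, 'p, 'b) func" where
  "unit_func J M = \<lparr>FObj = (\<lambda>x\<in>Obj J. Unit M), FArr = (\<lambda>f\<in>Arr J. Idt M (Unit M))\<rparr>"

definition fun_moncat ::
  "('o, 'a, 'x) cat_scheme \<Rightarrow> ('p, 'b, 'y) moncat_scheme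
    \<Rightarrow> (('o, 'a, 'p, 'b) func, (('o, 'a, 'p, 'b) func, 'o \<Rightarrow> 'b) arrow) moncat" where
  "fun_moncat J M =
     (let \<T> = tensor_func J M; \<I> = unit_func J M in
      \<lparr>Obj = Obj (fun_cat J M), Arr = Arr (fun_cat J M),
       Dom = Dom (fun_cat J M), Cod = Cod (fun_cat J M),
       Idt = Idt (fun_cat J M), Comp = Comp (fun_cat J M),
       TensO = \<T>,
       TensA = (\<lambda>\<alpha> \<beta>. Arrow (\<T> (source \<alpha>) (source \<beta>)) (\<T> (target \<alpha>) (target \<beta>))
                  (\<lambda>x\<in>Obj J. TensA M (under \<alpha> x) (under \<beta> x))),
       Unit = \<I>,
       Assoc = (\<lambda>F G H. Arrow (\<T> (\<T> F G) H) (\<T> F (\<T> G H))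
                  (\<lambda>x\<in>Obj J. Assoc M (FObj F x) (FObj G x) (FObj H x))),
       LUnit = (\<lambda>F. Arrow (\<T> \<I> F) F (\<lambda>x\<in>Obj J. LUnit M (FObj F x))),
       RUnit = (\<lambda>F. Arrow (\<T> F \<I>) F (\<lambda>x\<in>Obj J. RUnit M (FObj F x))),
       Braid = (\<lambda>F G. Arrow (\<T> F G) (\<T> G F) (\<lambda>x\<in>Obj J. Braid M (FObj F x) (FObj G x)))\<rparr>)"

type_synonym 'u gset = "('u, 'u, 'u set, ('u set, 'u \<Rightarrow> 'u) arrow) func"
type_synonym 'u gset_map = "('u gset, 'u \<Rightarrow> ('u set, 'u \<Rightarrow> 'u) arrow) arrow"

definition GSet :: "'u itself \<Rightarrow> 'u gpd \<Rightarrow> ('u gset, 'u gset_map) moncat" where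
  "GSet U G = fun_moncat G (Set_moncat U)"

text \<open>
  For \<open>f : G \<rightarrow> H\<close>, precomposition with \<open>f\<close>. It preserves the chosen products strictly, so its
  monoidal structure consists of identities.
\<close>

definition pullback ::
  "'u itself \<Rightarrow> 'u gpd \<Rightarrow> 'u gpd \<Rightarrow> 'u gpd_func \<Rightarrow> ('u gset, 'u gset_map) ring_func" where
  "pullback U G H f =
     \<lparr>FObj = (\<lambda>X\<in>Obj (GSet U H). comp_func G X f),
      FArr = (\<lambda>a\<in>Arr (GSet U H).
                Arrow (comp_func G (source a) f) (comp_func G (target a) f)
                  (compose (Obj G) (under a) (FObj f))),
      MuF = (\<lambda>(X, Y)\<in>Obj (GSet U H) \<times> Obj (GSet U H).
               Idt (GSet U G) (comp_func G (TensO (GSet U H) X Y) f)),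
      EpsF = Idt (GSet U G) (Unit (GSet U G))\<rparr>"

text \<open>For \<open>\<alpha> : f \<Rightarrow> g : G \<rightarrow> H\<close>, the transformation \<open>f\<^sup>* \<Rightarrow> g\<^sup>*\<close> with components \<open>X(\<alpha>\<^sub>x)\<close>.\<close>

definition pullback_trans ::
  "'u itself \<Rightarrow> 'u gpd \<Rightarrow> 'u gpd \<Rightarrow> ('u gpd_func, 'u \<Rightarrow> 'u) arrow
    \<Rightarrow> (('u gset, 'u gset_map) ring_func, 'u gset \<Rightarrow> 'u gset_map) arrow" where
  "pullback_trans U G H \<alpha> =
     Arrow (pullback U G H (source \<alpha>)) (pullback U G H (target \<alpha>))
       (\<lambda>X\<in>Obj (GSet U H).
          Arrow (comp_func G X (source \<alpha>)) (comp_func G X (target \<alpha>))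
            (\<lambda>x\<in>Obj G. FArr X (under \<alpha> x)))"

text \<open>The 2-functor \<open>G \<mapsto> 2Spec(Fun(G, Set))\<close> from \<^const>\<open>Gpd\<close> to \<^const>\<open>TwoAfSch\<close>.\<close>

definition TwoSpecSet ::
  "'u itself \<Rightarrow>
    ('u gpd, 'u gpd_func, ('u gpd_func, 'u \<Rightarrow> 'u) arrow,
     ('u gset, 'u gset_map) moncat, ('u gset, 'u gset_map) ring_func,
     (('u gset, 'u gset_map) ring_func, 'u gset \<Rightarrow> 'u gset_map) arrow) two_func" where
  "TwoSpecSet U =
     \<lparr>TObj = GSet U, TCell1 = pullback U, TCell2 = pullback_trans U\<rparr>"

end

theory Submission
  imports Defs
begin

text \<open>
  The counterexample is an infinite power of the discrete groupoid with two objects. On discrete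
  groupoids the functor takes \<open>X\<close> to the category of families of sets indexed by \<open>X\<close>, and a
  morphism of 2-rings from this category to a frame (a small complete lattice whose tensor product
  is the binary meet, with meets distributing over joins) is the same as a partition of the top
  element into pieces indexed by \<open>X\<close>. So, seen from frames, the product of the images of
  discrete groupoids \<open>X i\<close> is the product of the discrete spaces \<open>X i\<close> formed with locales, and
  for infinitely many factors this is not discrete: for \<open>X i = {a, b}\<close> it is Cantor space.

  In detail, let \<open>E\<close> be a copy of \<open>\<Prod>i\<in>I. {a, b}\<close> inside the universe, with projections \<open>p i\<close>, and
  let \<open>T\<close> be the frame of open sets of \<open>E\<close>. The discrete groupoid on \<open>E\<close> is the product in groupoids
  (\<open>is_product_disc\<close>), and \<open>T\<close> is a commutative 2-ring (\<open>commutative_2ring_opens\<close>). Since the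
  fibres of \<open>p i\<close> are open, sending a family over \<open>{a, b}\<close> to the set of those \<open>e \<in> E\<close> for which
  the set at \<open>p i e\<close> is nonempty is a ring morphism to \<open>T\<close>
  (\<open>support_functor_in_com2ring_hom\<close>). If products were preserved, these morphisms would factor, up
  to isomorphism, through one cocontinuous monoidal functor \<open>f\<close> from families over \<open>E\<close> to \<open>T\<close>. The
  family \<open>\<delta> e\<close> with one point at \<open>e\<close> and nothing elsewhere maps into the pullback of the analogous
  family at \<open>p i e\<close> for every \<open>i\<close>, so the open set \<open>f (\<delta> e)\<close> is contained in \<open>{e}\<close>, hence empty
  because Cantor space has no isolated points. But the tensor unit is the coproduct of the \<open>\<delta> e\<close>
  (\<open>unit_is_colimit_of_points\<close>), so \<open>f\<close> sends the unit to the empty set instead of \<open>E\<close>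
  (\<open>GSet_product_not_preserved\<close>).
\<close>

section \<open>Small sets\<close>

lemma small_lepoll: "X \<lesssim> Y \<Longrightarrow> small U Y \<Longrightarrow> small U X"
  unfolding small_def by (rule lesspoll_trans1)

lemma small_subset: "X \<subseteq> Y \<Longrightarrow> small U Y \<Longrightarrow> small U X"
  by (rule small_lepoll[OF subset_imp_lepoll])

lemma small_image: "small U X \<Longrightarrow> small U (f ` X)"
  by (rule small_lepoll[OF image_lepoll])

lemma small_copy:
  assumes "small (U :: 'u itself) X"
  obtains f :: "'x \<Rightarrow> 'u" where "inj_on f X"
  using assms unfolding small_def lesspoll_def lepoll_def by blast

context
  fixes U :: "'u itself"
  assumes inacc: "inaccessible U"
begin

lemma infinite_universe: "infinite (UNIV :: 'u set)"
  using inacc unfolding inaccessible_def infinite_le_lepoll by (blast intro: lesspoll_imp_lepoll)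

lemma two_elements: obtains t f :: 'u where "t \<noteq> f"
  using infinite_universe by (metis (full_types) UNIV_I finite.simps finite_subset insertI1 subsetI)

lemma small_finite: "finite X \<Longrightarrow> small U X"
  unfolding small_def by (rule finite_lesspoll_infinite[OF infinite_universe])

lemma small_countable: "small U (range (f :: nat \<Rightarrow> 'x))"
  using inacc unfolding inaccessible_def small_def by (meson image_lepoll lesspoll_trans1)

lemma small_Pow:
  assumes "small U X"
  shows "small U (Pow X)"
proof -
  obtain f :: "_ \<Rightarrow> 'u" where f: "inj_on f X" using small_copy[OF assms] .
  have "small U (Pow (f ` X))"
    using inacc small_image[OF assms] unfolding inaccessible_def small_def by blast
  moreover have "Pow X \<lesssim> Pow (f ` X)"
    unfolding lepoll_def by (rule exI[of _ "image f"]) (auto simp: inj_on_image_Pow[OF f])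
  ultimately show ?thesis by (rule small_lepoll[rotated])
qed

text \<open>
  In a small poset every object is little with respect to a cardinal exceeding the number of
  objects. The cardinal is taken infinite so that finite subsets of a directed poset have upper
  bounds as well.
\<close>

lemma small_larger_cardinal:
  assumes "small U X"
  obtains K :: "'u set" where "small U K" "infinite K" "X \<prec> K"
proof (cases "finite X")
  case True
  obtain f :: "nat \<Rightarrow> 'u" where "inj f"
    using infinite_universe unfolding infinite_iff_countable_subset by blast
  then have "infinite (range f)" by (simp add: range_inj_infinite)
  then show ?thesis using that True small_countable finite_lesspoll_infinite by blast
next
  case False
  obtain g :: "_ \<Rightarrow> 'u" where g: "inj_on g (Pow X)" using small_copy[OF small_Pow[OF assms]] .
  have "X \<prec> g ` Pow X" using g lesspoll_Pow_self by simp
  moreover have "infinite (g ` Pow X)" using False g by (simp add: finite_image_iff)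
  ultimately show ?thesis using that small_image[OF small_Pow[OF assms]] by blast
qed

lemma inj_upair: "inj (upair :: 'u \<times> 'u \<Rightarrow> 'u)"
proof -
  have "\<exists>p :: 'u \<times> 'u \<Rightarrow> 'u. inj p"
    using card_of_Times_same_infinite[OF infinite_universe]
    by (metis card_of_ordIso bij_betw_def UNIV_Times_UNIV)
  then show ?thesis unfolding upair_def by (rule someI_ex)
qed

lemma ufst_upair [simp]: "ufst (upair (x, y) :: 'u) = x"
  and usnd_upair [simp]: "usnd (upair (x, y) :: 'u) = y"
  by (simp_all add: ufst_def usnd_def inv_f_f[OF inj_upair])

lemma small_utimes:
  assumes "small U X" "small U (Y :: 'u set)"
  shows "small U (utimes X Y)"
proof -
  \<comment> \<open>A small union of small sets indexed by \<open>X\<close>, so closure under such unions applies.\<close>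
  have "utimes X Y = (\<Union>x\<in>X. (\<lambda>y. upair (x, y)) ` Y)"
    unfolding utimes_def by auto
  then show ?thesis
    using inacc assms small_image[OF assms(2)] unfolding inaccessible_def small_def by metis
qed

end

section \<open>Functor categories, product categories and categories with only identity arrows\<close>

lemma fun_cat_simps [simp]:
  "Obj (fun_cat C D) = {F. is_functor C D F}"
  "Dom (fun_cat C D) = source" "Cod (fun_cat C D) = target"
  "Idt (fun_cat C D) = idt_trans C D" "Comp (fun_cat C D) = vcomp C D"
  by (simp_all add: fun_cat_def)

lemma prod_cat_simps [simp]:
  "Obj (prod_cat I C') = (\<Pi>\<^sub>E i\<in>I. Obj (C' i))"
  "Arr (prod_cat I C') = (\<Pi>\<^sub>E i\<in>I. Arr (C' i))"
  "Dom (prod_cat I C') f = (\<lambda>i\<in>I. Dom (C' i) (f i))"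
  "Cod (prod_cat I C') f = (\<lambda>i\<in>I. Cod (C' i) (f i))"
  "Idt (prod_cat I C') x = (\<lambda>i\<in>I. Idt (C' i) (x i))"
  "Comp (prod_cat I C') g f = (\<lambda>i\<in>I. Comp (C' i) (g i) (f i))"
  by (simp_all add: prod_cat_def)

lemma HomI: "f \<in> Arr C \<Longrightarrow> Dom C f = x \<Longrightarrow> Cod C f = y \<Longrightarrow> f \<in> Hom C x y"
  by (simp add: Hom_def)

lemma HomD: "f \<in> Hom C x y \<Longrightarrow> f \<in> Arr C \<and> Dom C f = x \<and> Cod C f = y"
  by (simp add: Hom_def)

context
  fixes C :: "('o, 'a, 'z) cat_scheme"
  assumes C: "category C"
begin

lemma Dom_in_Obj: "f \<in> Arr C \<Longrightarrow> Dom C f \<in> Obj C"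
  and Cod_in_Obj: "f \<in> Arr C \<Longrightarrow> Cod C f \<in> Obj C"
  and Idt_in_Hom: "x \<in> Obj C \<Longrightarrow> Idt C x \<in> Hom C x x"
  and Comp_in_Hom: "f \<in> Hom C x y \<Longrightarrow> g \<in> Hom C y z \<Longrightarrow> Comp C g f \<in> Hom C x z"
  and Comp_Idt: "f \<in> Hom C x y \<Longrightarrow> Comp C f (Idt C x) = f"
  and Idt_Comp: "f \<in> Hom C x y \<Longrightarrow> Comp C (Idt C y) f = f"
  and Comp_assoc: "f \<in> Hom C x y \<Longrightarrow> g \<in> Hom C y z \<Longrightarrow> h \<in> Hom C z w \<Longrightarrow>
    Comp C h (Comp C g f) = Comp C (Comp C h g) f"
  using C unfolding category_def Hom_def by auto

lemma Hom_in_Obj: "f \<in> Hom C x y \<Longrightarrow> x \<in> Obj C \<and> y \<in> Obj C"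
  using Dom_in_Obj Cod_in_Obj unfolding Hom_def by blast

lemma Idt_is_iso: "x \<in> Obj C \<Longrightarrow> is_iso C (Idt C x)"
  using Idt_in_Hom[of x] Comp_Idt[OF Idt_in_Hom, of x] unfolding is_iso_def Hom_def by auto

end

lemma is_functorD:
  assumes "is_functor C D F"
  shows "x \<in> Obj C \<Longrightarrow> FObj F x \<in> Obj D"
    and "f \<in> Hom C x y \<Longrightarrow> FArr F f \<in> Hom D (FObj F x) (FObj F y)"
    and "x \<in> Obj C \<Longrightarrow> FArr F (Idt C x) = Idt D (FObj F x)"
    and "f \<in> Hom C x y \<Longrightarrow> g \<in> Hom C y z \<Longrightarrow> FArr F (Comp C g f) = Comp D (FArr F g) (FArr F f)"
    and "FObj F \<in> extensional (Obj C)" and "FArr F \<in> extensional (Arr C)"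
  using assms unfolding is_functor_def Hom_def by (auto simp: PiE_def)

lemma is_functor_comp_func:
  assumes C: "category C" and F: "is_functor C D F" and G: "is_functor D E G"
  shows "is_functor C E (comp_func C G F)"
proof -
  note F' = is_functorD[OF F] and G' = is_functorD[OF G]
  have a: "f \<in> Hom C (Dom C f) (Cod C f)" if "f \<in> Arr C" for f
    using that by (simp add: Hom_def)
  have b: "FArr F f \<in> Hom D (FObj F (Dom C f)) (FObj F (Cod C f))" if "f \<in> Arr C" for f
    using F'(2)[OF a[OF that]] .
  show ?thesis
    unfolding is_functor_def comp_func_def
  proof (simp, intro conjI ballI impI)
    show "compose (Obj C) (FObj G) (FObj F) \<in> Obj C \<rightarrow>\<^sub>E Obj E"
      using F'(1) G'(1) by (auto simp: compose_def)
  next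
    fix f assume f: "f \<in> Arr C"
    show "compose (Arr C) (FArr G) (FArr F) f \<in> Hom E (compose (Obj C) (FObj G) (FObj F) (Dom C f))
        (compose (Obj C) (FObj G) (FObj F) (Cod C f))"
      using G'(2)[OF b[OF f]] f Dom_in_Obj[OF C f] Cod_in_Obj[OF C f] by (simp add: compose_def)
  next
    fix x assume x: "x \<in> Obj C"
    have "Idt C x \<in> Arr C" using Idt_in_Hom[OF C x] by (simp add: Hom_def)
    then show "compose (Arr C) (FArr G) (FArr F) (Idt C x) = Idt E (compose (Obj C) (FObj G) (FObj F) x)"
      using x F' G' by (simp add: compose_def)
  next
    fix f g assume f: "f \<in> Arr C" and g: "g \<in> Arr C" and fg: "Cod C f = Dom C g"
    have g': "g \<in> Hom C (Cod C f) (Cod C g)" using g fg by (simp add: Hom_def)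
    have "Comp C g f \<in> Arr C" using Comp_in_Hom[OF C a[OF f] g'] by (simp add: Hom_def)
    then show "compose (Arr C) (FArr G) (FArr F) (Comp C g f) =
        Comp E (compose (Arr C) (FArr G) (FArr F) g) (compose (Arr C) (FArr G) (FArr F) f)"
      using F'(4)[OF a[OF f] g'] G'(4)[OF b[OF f] F'(2)[OF g']] f g by (simp add: compose_def)
  qed
qed

lemma nat_transD:
  assumes "nat_trans C D F G \<eta>"
  shows "\<eta> \<in> extensional (Obj C)" and "x \<in> Obj C \<Longrightarrow> \<eta> x \<in> Hom D (FObj F x) (FObj G x)"
    and "f \<in> Hom C x y \<Longrightarrow> Comp D (\<eta> y) (FArr F f) = Comp D (FArr G f) (\<eta> x)"
  using assms unfolding nat_trans_def Hom_def by auto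

lemma Hom_fun_cat:
  "\<alpha> \<in> Hom (fun_cat C D) F G \<longleftrightarrow>
     is_functor C D F \<and> is_functor C D G \<and> source \<alpha> = F \<and> target \<alpha> = G \<and> nat_trans C D F G (under \<alpha>)"
  unfolding Hom_def fun_cat_def by (cases \<alpha>) auto

lemma nat_trans_Idt:
  assumes C: "category C" and D: "category D" and F: "is_functor C D F"
  shows "nat_trans C D F F (\<lambda>x\<in>Obj C. Idt D (FObj F x))"
proof -
  note F' = is_functorD[OF F]
  have "Comp D (Idt D (FObj F (Cod C f))) (FArr F f) = Comp D (FArr F f) (Idt D (FObj F (Dom C f)))"
    if "f \<in> Arr C" for f
    using F'(2)[of f "Dom C f" "Cod C f"] Comp_Idt[OF D] Idt_Comp[OF D] that by (metis HomI)
  then show ?thesis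
    using F'(1) Idt_in_Hom[OF D] Dom_in_Obj[OF C] Cod_in_Obj[OF C]
    unfolding nat_trans_def by auto
qed

lemma nat_trans_vcomp:
  assumes C: "category C" and D: "category D"
    and F: "is_functor C D F" and G: "is_functor C D G" and H: "is_functor C D H"
    and \<alpha>: "nat_trans C D F G \<alpha>" and \<beta>: "nat_trans C D G H \<beta>"
  shows "nat_trans C D F H (\<lambda>x\<in>Obj C. Comp D (\<beta> x) (\<alpha> x))"
  unfolding nat_trans_def
proof (intro conjI ballI)
  fix x assume "x \<in> Obj C"
  then show "(\<lambda>x\<in>Obj C. Comp D (\<beta> x) (\<alpha> x)) x \<in> Hom D (FObj F x) (FObj H x)"
    using Comp_in_Hom[OF D nat_transD(2)[OF \<alpha>] nat_transD(2)[OF \<beta>]] by simp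
next
  fix f assume "f \<in> Arr C"
  then have f: "f \<in> Hom C (Dom C f) (Cod C f)" by (simp add: Hom_def)
  note x = Hom_in_Obj[OF C f, THEN conjunct1] and y = Hom_in_Obj[OF C f, THEN conjunct2]
  note Ff = is_functorD(2)[OF F f] and Gf = is_functorD(2)[OF G f] and Hf = is_functorD(2)[OF H f]
  note ax = nat_transD(2)[OF \<alpha> x] and ay = nat_transD(2)[OF \<alpha> y]
    and bx = nat_transD(2)[OF \<beta> x] and by' = nat_transD(2)[OF \<beta> y]
  have "Comp D (Comp D (\<beta> (Cod C f)) (\<alpha> (Cod C f))) (FArr F f)
      = Comp D (FArr H f) (Comp D (\<beta> (Dom C f)) (\<alpha> (Dom C f)))"
    by (metis Comp_assoc[OF D Ff ay by'] Comp_assoc[OF D ax Gf by'] Comp_assoc[OF D ax bx Hf]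
        nat_transD(3)[OF \<alpha> f] nat_transD(3)[OF \<beta> f])
  then show "Comp D ((\<lambda>x\<in>Obj C. Comp D (\<beta> x) (\<alpha> x)) (Cod C f)) (FArr F f)
      = Comp D (FArr H f) ((\<lambda>x\<in>Obj C. Comp D (\<beta> x) (\<alpha> x)) (Dom C f))"
    using x y by simp
qed auto

lemma categoryI:
  assumes "\<And>f. f \<in> Arr C \<Longrightarrow> Dom C f \<in> Obj C \<and> Cod C f \<in> Obj C"
    and "\<And>x. x \<in> Obj C \<Longrightarrow> Idt C x \<in> Hom C x x"
    and "\<And>f g x y z. f \<in> Hom C x y \<Longrightarrow> g \<in> Hom C y z \<Longrightarrow> Comp C g f \<in> Hom C x z"
    and "\<And>f x y. f \<in> Hom C x y \<Longrightarrow> Comp C f (Idt C x) = f \<and> Comp C (Idt C y) f = f"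
    and "\<And>f g h x y z w. f \<in> Hom C x y \<Longrightarrow> g \<in> Hom C y z \<Longrightarrow> h \<in> Hom C z w \<Longrightarrow>
      Comp C h (Comp C g f) = Comp C (Comp C h g) f"
  shows "category C"
proof -
  have h: "f \<in> Hom C (Dom C f) (Cod C f)" if "f \<in> Arr C" for f
    using that by (simp add: Hom_def)
  have h': "g \<in> Hom C (Cod C f) (Cod C g)" if "g \<in> Arr C" "Cod C f = Dom C g" for f g
    using that by (simp add: Hom_def)
  show ?thesis
    unfolding category_def
    using assms(1,2) assms(3)[OF h h'] assms(4)[OF h] assms(5)[OF h h' h'] by blast
qed

lemma category_fun_cat:
  assumes C: "category C" and D: "category D"
  shows "category (fun_cat C D)"
proof (rule categoryI)
  fix \<alpha> assume "\<alpha> \<in> Arr (fun_cat C D)"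
  then show "Dom (fun_cat C D) \<alpha> \<in> Obj (fun_cat C D) \<and> Cod (fun_cat C D) \<alpha> \<in> Obj (fun_cat C D)"
    by (auto simp: fun_cat_def)
next
  fix F assume "F \<in> Obj (fun_cat C D)"
  then show "Idt (fun_cat C D) F \<in> Hom (fun_cat C D) F F"
    using nat_trans_Idt[OF C D] by (simp add: Hom_fun_cat idt_trans_def)
next
  fix \<alpha> \<beta> F G H
  assume "\<alpha> \<in> Hom (fun_cat C D) F G" "\<beta> \<in> Hom (fun_cat C D) G H"
  then show "Comp (fun_cat C D) \<beta> \<alpha> \<in> Hom (fun_cat C D) F H"
    using nat_trans_vcomp[OF C D] by (auto simp: Hom_fun_cat vcomp_def)
next
  fix \<alpha> F G assume "\<alpha> \<in> Hom (fun_cat C D) F G"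
  then have a: "source \<alpha> = F" "target \<alpha> = G" "nat_trans C D F G (under \<alpha>)"
    by (auto simp: Hom_fun_cat)
  note b = nat_transD(1)[OF a(3)] and c = nat_transD(2)[OF a(3)]
  have "(\<lambda>x\<in>Obj C. Comp D (under \<alpha> x) (Idt D (FObj F x))) = under \<alpha>"
    "(\<lambda>x\<in>Obj C. Comp D (Idt D (FObj G x)) (under \<alpha> x)) = under \<alpha>"
    using Comp_Idt[OF D c] Idt_Comp[OF D c] b
    by (auto intro!: extensionalityI[of _ "Obj C"])
  then show "Comp (fun_cat C D) \<alpha> (Idt (fun_cat C D) F) = \<alpha> \<and> Comp (fun_cat C D) (Idt (fun_cat C D) G) \<alpha> = \<alpha>"
    using a(1,2) by (cases \<alpha>) (simp add: vcomp_def idt_trans_def cong: restrict_cong)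
next
  fix \<alpha> \<beta> \<gamma> F G H K
  assume "\<alpha> \<in> Hom (fun_cat C D) F G" "\<beta> \<in> Hom (fun_cat C D) G H" "\<gamma> \<in> Hom (fun_cat C D) H K"
  then have "nat_trans C D F G (under \<alpha>)" "nat_trans C D G H (under \<beta>)" "nat_trans C D H K (under \<gamma>)"
    by (auto simp: Hom_fun_cat)
  note nat_transD(2)[OF this(1)] nat_transD(2)[OF this(2)] nat_transD(2)[OF this(3)]
  note Comp_assoc[OF D this]
  then show "Comp (fun_cat C D) \<gamma> (Comp (fun_cat C D) \<beta> \<alpha>) = Comp (fun_cat C D) (Comp (fun_cat C D) \<gamma> \<beta>) \<alpha>"
    by (auto simp: vcomp_def cong: restrict_cong)
qed

lemma Hom_prod_cat:
  "f \<in> Hom (prod_cat I C) x y \<Longrightarrow> i \<in> I \<Longrightarrow> f i \<in> Hom (C i) (x i) (y i)"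
  unfolding Hom_def by auto

lemma Hom_prod_catI:
  assumes "f \<in> extensional I" "x \<in> extensional I" "y \<in> extensional I"
    and "\<And>i. i \<in> I \<Longrightarrow> f i \<in> Hom (C i) (x i) (y i)"
  shows "f \<in> Hom (prod_cat I C) x y"
proof -
  have "(\<lambda>i\<in>I. Dom (C i) (f i)) = x" "(\<lambda>i\<in>I. Cod (C i) (f i)) = y"
    using assms by (auto simp: Hom_def intro!: extensionalityI[of _ I])
  moreover have "f \<in> Arr (prod_cat I C)"
    using assms(1,4) by (simp add: PiE_iff Hom_def)
  ultimately show ?thesis by (simp add: Hom_def)
qed

lemma category_prod_cat:
  assumes C: "\<And>i. i \<in> I \<Longrightarrow> category (C i)"
  shows "category (prod_cat I C)"
proof (rule categoryI)
  fix f assume "f \<in> Arr (prod_cat I C)"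
  then show "Dom (prod_cat I C) f \<in> Obj (prod_cat I C) \<and> Cod (prod_cat I C) f \<in> Obj (prod_cat I C)"
    using Dom_in_Obj[OF C] Cod_in_Obj[OF C] by (simp add: PiE_iff)
next
  fix x assume "x \<in> Obj (prod_cat I C)"
  then show "Idt (prod_cat I C) x \<in> Hom (prod_cat I C) x x"
    using Idt_in_Hom[OF C] by (intro Hom_prod_catI) (auto simp: PiE_iff)
next
  fix f g x y z
  assume f: "f \<in> Hom (prod_cat I C) x y" and g: "g \<in> Hom (prod_cat I C) y z"
  have "x \<in> extensional I" "z \<in> extensional I" using f g by (auto simp: Hom_def)
  then show "Comp (prod_cat I C) g f \<in> Hom (prod_cat I C) x z"
    using Comp_in_Hom[OF C Hom_prod_cat[OF f] Hom_prod_cat[OF g]] by (intro Hom_prod_catI) auto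
next
  fix f x y assume f: "f \<in> Hom (prod_cat I C) x y"
  have "f \<in> extensional I" using f by (auto simp: Hom_def PiE_iff)
  then show "Comp (prod_cat I C) f (Idt (prod_cat I C) x) = f \<and> Comp (prod_cat I C) (Idt (prod_cat I C) y) f = f"
    using Comp_Idt[OF C Hom_prod_cat[OF f]] Idt_Comp[OF C Hom_prod_cat[OF f]]
    by (auto intro!: extensionalityI[of _ I])
next
  fix f g h x y z w
  assume f: "f \<in> Hom (prod_cat I C) x y" and g: "g \<in> Hom (prod_cat I C) y z" and h: "h \<in> Hom (prod_cat I C) z w"
  show "Comp (prod_cat I C) h (Comp (prod_cat I C) g f) = Comp (prod_cat I C) (Comp (prod_cat I C) h g) f"
    using Comp_assoc[OF C Hom_prod_cat[OF f] Hom_prod_cat[OF g] Hom_prod_cat[OF h]]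
    by (auto cong: restrict_cong)
qed

definition only_identities :: "('o, 'a, 'z) cat_scheme \<Rightarrow> bool" where
  "only_identities C \<longleftrightarrow> (\<forall>f\<in>Arr C. f = Idt C (Dom C f))"

lemma only_identitiesD:
  assumes "only_identities C" "category C" "f \<in> Hom C x y"
  shows "x = y" "f = Idt C x"
proof -
  have "f = Idt C x" "x \<in> Obj C"
    using assms Hom_in_Obj[OF assms(2,3)] unfolding only_identities_def Hom_def by auto
  then show "f = Idt C x" "x = y"
    using assms(3) Idt_in_Hom[OF assms(2), of x] by (auto simp: Hom_def)
qed

lemma only_identities_prod_cat:
  assumes "\<And>i. i \<in> I \<Longrightarrow> only_identities (C i)"
  shows "only_identities (prod_cat I C)"
  unfolding only_identities_def
proof
  fix f assume f: "f \<in> Arr (prod_cat I C)"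
  then have "f i = Idt (C i) (Dom (C i) (f i))" if "i \<in> I" for i
    using assms[OF that] that unfolding only_identities_def by (simp add: PiE_iff)
  then show "f = Idt (prod_cat I C) (Dom (prod_cat I C) f)"
    using f by (intro extensionalityI[of _ I]) (simp_all add: PiE_iff)
qed

lemma nat_isomorphic_if_equal_values:
  assumes "category C" "category D" "is_functor C D F" 
    and "\<And>x. x \<in> Obj C \<Longrightarrow> FObj G x = FObj F x" "\<And>f. f \<in> Arr C \<Longrightarrow> FArr G f = FArr F f"
  shows "nat_isomorphic C D F G"
proof -
  note n = nat_trans_Idt[OF assms(1-3)]
  then have "nat_trans C D F G (\<lambda>x\<in>Obj C. Idt D (FObj F x))"
    using assms(4,5) unfolding nat_trans_def by auto
  then show ?thesis unfolding nat_isomorphic_def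
    using Idt_is_iso[OF assms(2)] is_functorD(1)[OF assms(3)] by fastforce
qed

lemma is_functor_only_identities:
  assumes C: "category C" "only_identities C" and D: "category D"
    and "FObj F \<in> Obj C \<rightarrow>\<^sub>E Obj D" "FArr F \<in> extensional (Arr C)"
    and "\<And>x. x \<in> Obj C \<Longrightarrow> FArr F (Idt C x) = Idt D (FObj F x)"
  shows "is_functor C D F"
  unfolding is_functor_def
proof (intro conjI ballI impI)
  fix f assume "f \<in> Arr C"
  then have f: "f \<in> Hom C (Dom C f) (Cod C f)" by (simp add: Hom_def)
  then show "FArr F f \<in> Hom D (FObj F (Dom C f)) (FObj F (Cod C f))"
    using only_identitiesD[OF C(2,1) f] assms(4,6) Idt_in_Hom[OF D] Hom_in_Obj[OF C(1) f]
    by (metis PiE_mem)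
next
  fix f g assume f: "f \<in> Arr C" and g: "g \<in> Arr C" "Cod C f = Dom C g"
  define x where "x = Dom C f"
  have x: "x \<in> Obj C" using f Dom_in_Obj[OF C(1)] x_def by simp
  have "f = Idt C x" "g = Idt C x"
    using only_identitiesD[OF C(2,1), of f x "Cod C f"] only_identitiesD[OF C(2,1), of g "Dom C g" "Cod C g"]
      f g by (auto simp: x_def Hom_def)
  moreover have "Comp C (Idt C x) (Idt C x) = Idt C x"
    using Comp_Idt[OF C(1) Idt_in_Hom[OF C(1) x]] .
  moreover have "Comp D (Idt D (FObj F x)) (Idt D (FObj F x)) = Idt D (FObj F x)"
    using Comp_Idt[OF D Idt_in_Hom[OF D]] assms(4) x by (auto simp: PiE_mem)
  ultimately show "FArr F (Comp C g f) = Comp D (FArr F g) (FArr F f)"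
    using assms(6)[OF x] by simp
qed (use assms in auto)

text \<open>
  Between categories whose arrows are all identities, a functor that is bijective on objects has a
  strict inverse, and both natural isomorphisms can be taken to be identities. The comparison functor
  of a cone of discrete groupoids is of this kind.
\<close>

lemma is_equivalence_only_identities:
  fixes F :: "('o, 'a, 'p, 'b) func"
  assumes C: "category C" "only_identities C" and D: "category D" "only_identities D"
    and F: "is_functor C D F" and bij: "bij_betw (FObj F) (Obj C) (Obj D)"
  shows "is_equivalence C D F"
proof -
  define G :: "('p, 'b, 'o, 'a) func" where
    "G = \<lparr>FObj = (\<lambda>y\<in>Obj D. inv_into (Obj C) (FObj F) y),
          FArr = (\<lambda>g\<in>Arr D. Idt C (inv_into (Obj C) (FObj F) (Dom D g)))\<rparr>"
  have inv: "inv_into (Obj C) (FObj F) y \<in> Obj C" "FObj F (inv_into (Obj C) (FObj F) y) = y"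
    if "y \<in> Obj D" for y
    using that bij by (auto simp: bij_betw_def inv_into_into f_inv_into_f)
  have inv': "inv_into (Obj C) (FObj F) (FObj F x) = x" if "x \<in> Obj C" for x
    using that bij by (auto simp: bij_betw_def)
  note F' = is_functorD[OF F]
  have IdtD: "Idt D y \<in> Arr D" "Dom D (Idt D y) = y" if "y \<in> Obj D" for y
    using Idt_in_Hom[OF D(1) that] by (auto simp: Hom_def)
  have G: "is_functor D C G"
    by (rule is_functor_only_identities[OF D C(1)]) (auto simp: G_def inv IdtD)
  have C_arr: "f = Idt C (Dom C f)" "Dom C f \<in> Obj C" if "f \<in> Arr C" for f
    using that C(2) Dom_in_Obj[OF C(1)] by (auto simp: only_identities_def)
  have D_arr: "f = Idt D (Dom D f)" "Dom D f \<in> Obj D" if "f \<in> Arr D" for f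
    using that D(2) Dom_in_Obj[OF D(1)] by (auto simp: only_identities_def)
  have idC: "is_functor C C (id_func C)"
    using Idt_in_Hom[OF C(1)]
    by (intro is_functor_only_identities[OF C C(1)]) (auto simp: id_func_def Hom_def)
  have Go: "FObj G (FObj F x) = x" if "x \<in> Obj C" for x
    using that F'(1) inv' by (simp add: G_def)
  have Fo: "FObj F (FObj G y) = y" if "y \<in> Obj D" for y
    using that inv by (simp add: G_def)
  have GF: "FArr G (FArr F f) = f" if "f \<in> Arr C" for f
    using C_arr[OF that] F'(1,3) IdtD inv' unfolding G_def by (metis (no_types, lifting) func.simps(2) restrict_apply')
  have FG: "FArr F (FArr G f) = f" if "f \<in> Arr D" for f
    using D_arr[OF that] F'(3) inv that by (auto simp: G_def)
  have "nat_isomorphic C C (id_func C) (comp_func C G F)"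
    by (rule nat_isomorphic_if_equal_values[OF C(1) C(1) idC])
      (auto simp: id_func_def comp_func_def compose_def GF Go)
  moreover have "nat_isomorphic D D (comp_func D F G) (id_func D)"
    by (rule nat_isomorphic_if_equal_values[OF D(1) D(1) is_functor_comp_func[OF D(1) G F]])
      (auto simp: id_func_def comp_func_def compose_def FG Fo)
  ultimately show ?thesis
    unfolding is_equivalence_def using F G by blast
qed

section \<open>Products of discrete groupoids\<close>

definition disc :: "'x set \<Rightarrow> ('x, 'x) cat" where
  "disc X =
     \<lparr>Obj = X, Arr = X, Dom = (\<lambda>x. x), Cod = (\<lambda>x. x), Idt = (\<lambda>x. x), Comp = (\<lambda>g f. f)\<rparr>"

definition disc_map :: "'x set \<Rightarrow> ('x \<Rightarrow> 'y) \<Rightarrow> ('x, 'x, 'y, 'y) func" where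
  "disc_map X p = \<lparr>FObj = restrict p X, FArr = restrict p X\<rparr>"

lemma disc_simps [simp]:
  "Obj (disc X) = X" "Arr (disc X) = X" "Dom (disc X) x = x" "Cod (disc X) x = x"
  "Idt (disc X) x = x" "Comp (disc X) g x = x"
  by (simp_all add: disc_def)

lemma disc_map_simps [simp]:
  "FObj (disc_map X p) = restrict p X" "FArr (disc_map X p) = restrict p X"
  by (simp_all add: disc_map_def)

lemma Hom_disc [simp]: "f \<in> Hom (disc X) x y \<longleftrightarrow> f \<in> X \<and> x = f \<and> y = f"
  by (auto simp: Hom_def)

lemma category_disc: "category (disc X)"
  by (rule categoryI) auto

lemma groupoid_disc: "groupoid (disc X)"
  using category_disc by (auto simp: groupoid_def is_iso_def)

lemma only_identities_disc: "only_identities (disc X)"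
  by (simp add: only_identities_def)

lemma disc_in_Gpd: "small U X \<Longrightarrow> disc X \<in> Ob (Gpd U)"
  by (simp add: Gpd_def groupoid_disc small_category_def category_disc)

lemma is_functor_disc_map: "p \<in> X \<rightarrow> Y \<Longrightarrow> is_functor (disc X) (disc Y) (disc_map X p)"
  by (auto simp: is_functor_def)

lemma functor_into_disc:
  assumes "is_functor T (disc X) F" "f \<in> Arr T"
  shows "FObj F (Dom T f) = FArr F f" "FObj F (Cod T f) = FArr F f"
  using is_functorD(2)[OF assms(1), of f "Dom T f" "Cod T f"] assms(2) by (auto simp: Hom_def)

lemma functor_into_disc_eqI:
  assumes "is_functor T (disc X) F" "is_functor T (disc Y) G"
    and eq: "\<And>x. x \<in> Obj T \<Longrightarrow> FObj F x = FObj G x" and T: "category T"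
  shows "F = (G :: (_, _, _, _) func)"
proof -
  note F = is_functorD[OF assms(1)] and G = is_functorD[OF assms(2)]
  have "FObj F = FObj G"
    using extensionalityI[OF F(5) G(5)] eq by blast
  moreover have "FArr F f = FArr G f" if "f \<in> Arr T" for f
    using functor_into_disc(1)[OF assms(1) that] functor_into_disc(1)[OF assms(2) that]
      eq[OF Dom_in_Obj[OF T that]] by simp
  then have "FArr F = FArr G"
    using extensionalityI[OF F(6) G(6)] by blast
  ultimately show ?thesis by simp
qed

text \<open>
  A transformation between functors into a discrete category has identity components, so its source
  and target agree on objects, and then on arrows because an arrow is sent to the identity of the
  common value at its ends.
\<close>

lemma only_identities_fun_cat_disc:
  assumes T: "category T"
  shows "only_identities (fun_cat T (disc X))"
  unfolding only_identities_def
proof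
  fix \<alpha> assume "\<alpha> \<in> Arr (fun_cat T (disc X))"
  then have a: "\<alpha> \<in> Hom (fun_cat T (disc X)) (source \<alpha>) (target \<alpha>)"
    by (simp add: Hom_def)
  then have F: "is_functor T (disc X) (source \<alpha>)" and G: "is_functor T (disc X) (target \<alpha>)"
    and n: "nat_trans T (disc X) (source \<alpha>) (target \<alpha>) (under \<alpha>)"
    by (auto simp: Hom_fun_cat)
  have c: "under \<alpha> x = FObj (source \<alpha>) x" "FObj (target \<alpha>) x = FObj (source \<alpha>) x" if "x \<in> Obj T" for x
    using nat_transD(2)[OF n that] by auto
  have "source \<alpha> = target \<alpha>"
    by (rule functor_into_disc_eqI[OF F G _ T]) (simp add: c(2))
  moreover have "under \<alpha> = (\<lambda>x\<in>Obj T. FObj (source \<alpha>) x)"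
    using c nat_transD(1)[OF n] by (auto intro!: extensionalityI[of _ "Obj T"])
  ultimately show "\<alpha> = Idt (fun_cat T (disc X)) (Dom (fun_cat T (disc X)) \<alpha>)"
    by (cases \<alpha>) (simp add: idt_trans_def)
qed

text \<open>
  A functor \<open>T \<rightarrow> disc X\<close> is a function on objects that is constant along arrows. So the discrete
  groupoid on a product of sets is even a strict product of the discrete groupoids: the comparison
  functor is a bijection on objects between categories without non-identity arrows. The product set
  is given only up to bijection, because it has to live inside the universe.
\<close>

lemma is_product_disc:
  fixes p :: "'i \<Rightarrow> 'u \<Rightarrow> 'u"
  assumes small: "small U E" "\<And>i. i \<in> I \<Longrightarrow> small U (X i)"
    and bij: "bij_betw (\<lambda>e. \<lambda>i\<in>I. p i e) E (\<Pi>\<^sub>E i\<in>I. X i)"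
  shows "is_product (Gpd U) I (\<lambda>i. disc (X i)) (disc E) (\<lambda>i. disc_map E (p i))"
proof -
  have inj: "x = y" if "x \<in> E" "y \<in> E" "\<And>i. i \<in> I \<Longrightarrow> p i x = p i y" for x y
  proof -
    have "(\<lambda>i\<in>I. p i x) = (\<lambda>i\<in>I. p i y)" using that(3) by (auto cong: restrict_cong)
    then show ?thesis using bij that(1,2) by (auto simp: bij_betw_def inj_on_def)
  qed
  have p: "p i e \<in> X i" if "e \<in> E" "i \<in> I" for e i
  proof -
    have "(\<lambda>i\<in>I. p i e) \<in> (\<Pi>\<^sub>E i\<in>I. X i)" using bij_betw_apply[OF bij that(1)] .
    then show ?thesis using that(2) by (auto simp: PiE_iff)
  qed
  have pi: "is_functor (disc E) (disc (X i)) (disc_map E (p i))" if "i \<in> I" for i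
    using p that by (intro is_functor_disc_map) auto
  have "is_cone (Gpd U) I (\<lambda>i. disc (X i)) (disc E) (\<lambda>i. disc_map E (p i))"
    unfolding is_cone_def using small disc_in_Gpd pi by (auto simp: Gpd_def)
  moreover have "is_equivalence (fun_cat T (disc E)) (prod_cat I (\<lambda>i. fun_cat T (disc (X i))))
      (comparison (Gpd U) I (\<lambda>i. disc (X i)) (disc E) (\<lambda>i. disc_map E (p i)) T)"
    (is "is_equivalence ?C ?D ?F") if "T \<in> Ob (Gpd U)" for T
  proof -
    have T: "category T" using that by (simp add: Gpd_def small_category_def)
    have C: "category ?C" by (rule category_fun_cat[OF T category_disc])
    have D: "category ?D" by (intro category_prod_cat category_fun_cat T category_disc)
    have C': "only_identities ?C" by (rule only_identities_fun_cat_disc[OF T])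
    have D': "only_identities ?D"
      by (intro only_identities_prod_cat only_identities_fun_cat_disc T)
    have Fob: "FObj ?F = (\<lambda>f\<in>Obj ?C. \<lambda>i\<in>I. comp_func T (disc_map E (p i)) f)"
      by (simp add: comparison_def Gpd_def)
    have Farr: "FArr ?F = (\<lambda>\<alpha>\<in>Arr ?C. \<lambda>i\<in>I.
        hcomp T (disc (X i)) (comp_func T) (idt_trans (disc E) (disc (X i)) (disc_map E (p i))) \<alpha>)"
      by (simp add: comparison_def Gpd_def)
    have comp: "is_functor T (disc (X i)) (comp_func T (disc_map E (p i)) f)"
      if "is_functor T (disc E) f" "i \<in> I" for f i
      by (rule is_functor_comp_func[OF T that(1) pi[OF that(2)]])
    have "is_functor ?C ?D ?F"
    proof (rule is_functor_only_identities[OF C C' D])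
      show "FObj ?F \<in> Obj ?C \<rightarrow>\<^sub>E Obj ?D"
        using comp by (auto simp: Fob)
    next
      show "FArr ?F \<in> extensional (Arr ?C)" by (simp add: Farr)
    next
      fix f assume f: "f \<in> Obj ?C"
      then have "idt_trans T (disc E) f \<in> Arr ?C"
        using Idt_in_Hom[OF C f] by (simp add: Hom_def)
      moreover have "FObj f x \<in> E" if "x \<in> Obj T" for x
        using is_functorD(1)[of T "disc E" f x] f that by simp
      ultimately show "FArr ?F (Idt ?C f) = Idt ?D (FObj ?F f)"
        using f by (auto simp: Fob Farr hcomp_def idt_trans_def comp_func_def compose_def
            intro!: restrict_ext)
    qed
    moreover have "bij_betw (FObj ?F) (Obj ?C) (Obj ?D)"
    proof (rule bij_betw_imageI)
      show "inj_on (FObj ?F) (Obj ?C)"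
      proof (rule inj_onI)
        fix f g assume f: "f \<in> Obj ?C" and g: "g \<in> Obj ?C" and eq: "FObj ?F f = FObj ?F g"
        show "f = g"
        proof (rule functor_into_disc_eqI[OF _ _ _ T])
          show "is_functor T (disc E) f" "is_functor T (disc E) g" using f g by simp_all
          fix x assume x: "x \<in> Obj T"
          have fx: "FObj f x \<in> E" "FObj g x \<in> E"
            using is_functorD(1)[of T "disc E" f x] is_functorD(1)[of T "disc E" g x] f g x by simp_all
          show "FObj f x = FObj g x"
          proof (rule inj[OF fx])
            fix i assume i: "i \<in> I"
            have "FObj (FObj ?F f i) x = FObj (FObj ?F g i) x" using eq by simp
            then show "p i (FObj f x) = p i (FObj g x)"
              using f g i x fx by (simp add: Fob comp_func_def compose_def)
          qed
        qed
      qed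
    next
      show "FObj ?F ` Obj ?C = Obj ?D"
      proof
        show "FObj ?F ` Obj ?C \<subseteq> Obj ?D" using comp by (auto simp: Fob)
      next
        show "Obj ?D \<subseteq> FObj ?F ` Obj ?C"
        proof
          fix h assume h: "h \<in> Obj ?D"
          then have hi: "is_functor T (disc (X i)) (h i)" if "i \<in> I" for i
            using that by (simp add: PiE_iff)
          \<comment> \<open>The functors \<open>h i\<close> are glued pointwise: \<open>k x\<close> is the point of \<open>E\<close> with coordinates \<open>h i x\<close>.\<close>
          define k where "k x = inv_into E (\<lambda>e. \<lambda>i\<in>I. p i e) (\<lambda>i\<in>I. FObj (h i) x)" for x
          have k: "k x \<in> E" "\<And>i. i \<in> I \<Longrightarrow> p i (k x) = FObj (h i) x" if x: "x \<in> Obj T" for x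
          proof -
            have "FObj (h i) x \<in> X i" if "i \<in> I" for i
              using is_functorD(1)[OF hi[OF that] x] by simp
            then have "(\<lambda>i\<in>I. FObj (h i) x) \<in> (\<lambda>e. \<lambda>i\<in>I. p i e) ` E"
              using bij by (auto simp: bij_betw_def)
            note a = inv_into_into[OF this] f_inv_into_f[OF this]
            show "k x \<in> E" using a(1) by (simp add: k_def)
            fix i assume "i \<in> I"
            then show "p i (k x) = FObj (h i) x"
              using fun_cong[OF a(2), of i] by (simp add: k_def)
          qed
          have k_arr: "k (Dom T f) = k (Cod T f)" if "f \<in> Arr T" for f
            using functor_into_disc[OF hi that] by (auto simp: k_def cong: restrict_cong)
          define f where "f = \<lparr>FObj = (\<lambda>x\<in>Obj T. k x), FArr = (\<lambda>a\<in>Arr T. k (Dom T a))\<rparr>"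
          have f: "is_functor T (disc E) f"
            unfolding is_functor_def f_def
            using k(1) k_arr Dom_in_Obj[OF T] Cod_in_Obj[OF T] Idt_in_Hom[OF T] Comp_in_Hom[OF T]
            by (auto simp: Hom_def)
          have "comp_func T (disc_map E (p i)) f = h i" if i: "i \<in> I" for i
            by (rule functor_into_disc_eqI[OF comp[OF f i] hi[OF i] _ T])
              (simp add: comp_func_def compose_def f_def k i)
          then have "FObj ?F f = h"
            using h f by (auto simp: Fob PiE_iff intro!: extensionalityI[of _ I])
          then show "h \<in> FObj ?F ` Obj ?C" using f by force
        qed
      qed
    qed
    ultimately show ?thesis
      by (rule is_equivalence_only_identities[OF C C' D D'])
  qed
  then have "universal_cone (Gpd U) I (\<lambda>i. disc (X i)) (disc E) (\<lambda>i. disc_map E (p i))"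
    unfolding universal_cone_def by (simp add: Gpd_def)
  ultimately show ?thesis unfolding is_product_def by simp
qed

section \<open>Families of sets as a symmetric monoidal category\<close>

lemma set_map_simps [simp]:
  "source (set_map X Y f) = X" "target (set_map X Y f) = Y" "under (set_map X Y f) = restrict f X"
  by (simp_all add: set_map_def)

lemma set_cat_simps [simp]:
  "Obj (set_cat U) = {X. small U X}" "Dom (set_cat U) = source" "Cod (set_cat U) = target"
  "Idt (set_cat U) X = set_map X X (\<lambda>x. x)"
  "Comp (set_cat U) g f = set_map (source f) (target g) (\<lambda>x. under g (under f x))"
  by (simp_all add: set_cat_def)

lemma Hom_set_cat:
  "f \<in> Hom (set_cat U) X Y \<longleftrightarrow>
     small U X \<and> small U Y \<and> source f = X \<and> target f = Y \<and> under f \<in> X \<rightarrow>\<^sub>E Y"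
  by (cases f) (auto simp: Hom_def set_cat_def)

lemma set_map_in_Hom:
  "small U X \<Longrightarrow> small U Y \<Longrightarrow> (\<And>x. x \<in> X \<Longrightarrow> f x \<in> Y) \<Longrightarrow> set_map X Y f \<in> Hom (set_cat U) X Y"
  by (auto simp: Hom_set_cat)

lemma set_arrow_eqI:
  assumes "f \<in> Hom (set_cat U) X Y" "g \<in> Hom (set_cat U) X Y"
    and "\<And>x. x \<in> X \<Longrightarrow> under f x = under g x"
  shows "f = g"
proof (rule arrow.expand)
  have "under f = under g"
    using assms by (intro extensionalityI[of _ X]) (auto simp: Hom_set_cat PiE_iff)
  then show "source f = source g \<and> target f = target g \<and> under f = under g"
    using assms by (simp add: Hom_set_cat)
qed

lemma category_set_cat: "category (set_cat U)"
proof (rule categoryI)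
  fix f :: "('x set, 'x \<Rightarrow> 'x) arrow"
  assume "f \<in> Arr (set_cat U)"
  then show "Dom (set_cat U) f \<in> Obj (set_cat U) \<and> Cod (set_cat U) f \<in> Obj (set_cat U)"
    by (auto simp: set_cat_def)
next
  fix X :: "'x set" assume "X \<in> Obj (set_cat U)"
  then show "Idt (set_cat U) X \<in> Hom (set_cat U) X X" by (auto simp: Hom_set_cat)
next
  fix f g and X Y Z :: "'x set"
  assume "f \<in> Hom (set_cat U) X Y" "g \<in> Hom (set_cat U) Y Z"
  then show "Comp (set_cat U) g f \<in> Hom (set_cat U) X Z" by (auto simp: Hom_set_cat)
next
  fix f and X Y :: "'x set" assume f: "f \<in> Hom (set_cat U) X Y"
  then show "Comp (set_cat U) f (Idt (set_cat U) X) = f \<and> Comp (set_cat U) (Idt (set_cat U) Y) f = f"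
    by (intro conjI set_arrow_eqI[OF _ f]) (auto simp: Hom_set_cat)
next
  fix f g h and X Y Z W :: "'x set"
  assume "f \<in> Hom (set_cat U) X Y" "g \<in> Hom (set_cat U) Y Z" "h \<in> Hom (set_cat U) Z W"
  then show "Comp (set_cat U) h (Comp (set_cat U) g f) = Comp (set_cat U) (Comp (set_cat U) h g) f"
    by (auto simp: set_map_def Hom_set_cat intro!: restrict_ext)
qed

lemma Set_moncat_simps [simp]:
  "Obj (Set_moncat U) = Obj (set_cat U)" "Arr (Set_moncat U) = Arr (set_cat U)"
  "Dom (Set_moncat U) = source" "Cod (Set_moncat U) = target"
  "Idt (Set_moncat U) = Idt (set_cat U)" "Comp (Set_moncat U) = Comp (set_cat U)"
  "TensO (Set_moncat U) = utimes" "Unit (Set_moncat U) = upoint"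
  by (simp_all add: Set_moncat_def)

lemma Hom_Set_moncat [simp]: "Hom (Set_moncat U) X Y = Hom (set_cat U) X Y"
  by (simp add: Hom_def)

lemma category_Set_moncat: "category (Set_moncat U)"
  using category_set_cat[of U] by (simp add: category_def)

lemma is_functor_disc_iff:
  assumes D: "category D"
  shows "is_functor (disc X) D F \<longleftrightarrow>
    FObj F \<in> X \<rightarrow>\<^sub>E Obj D \<and> FArr F = (\<lambda>x\<in>X. Idt D (FObj F x))" (is "?L \<longleftrightarrow> ?R")
proof
  assume F: ?L
  note F' = is_functorD[OF F]
  have "FArr F = (\<lambda>x\<in>X. Idt D (FObj F x))"
    using F'(3,6) by (intro extensionalityI[of _ X]) auto
  then show ?R using F by (simp add: is_functor_def)
next
  assume ?R
  then show ?L
    by (intro is_functor_only_identities[OF category_disc only_identities_disc D]) auto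
qed

lemma nat_trans_disc_iff:
  assumes D: "category D" and "is_functor (disc X) D F" "is_functor (disc X) D G"
  shows "nat_trans (disc X) D F G \<eta> \<longleftrightarrow>
    \<eta> \<in> extensional X \<and> (\<forall>x\<in>X. \<eta> x \<in> Hom D (FObj F x) (FObj G x))"
  using assms(2,3) Comp_Idt[OF D] Idt_Comp[OF D]
  unfolding is_functor_disc_iff[OF D] nat_trans_def by auto

lemma GSet_simps [simp]:
  "Obj (GSet U G) = {F. is_functor G (Set_moncat U) F}"
  "Dom (GSet U G) = source" "Cod (GSet U G) = target"
  "Idt (GSet U G) = idt_trans G (Set_moncat U)" "Comp (GSet U G) = vcomp G (Set_moncat U)"
  "TensO (GSet U G) = tensor_func G (Set_moncat U)" "Unit (GSet U G) = unit_func G (Set_moncat U)"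
  by (simp_all add: GSet_def fun_moncat_def Let_def)

text \<open>
  Kept out of the simplifier: these values are large, and mostly only their type matters.
\<close>

lemma GSet_structure:
  "TensA (GSet U G) \<alpha> \<beta> = Arrow (TensO (GSet U G) (source \<alpha>) (source \<beta>))
     (TensO (GSet U G) (target \<alpha>) (target \<beta>))
     (\<lambda>x\<in>Obj G. TensA (Set_moncat U) (under \<alpha> x) (under \<beta> x))"
  "Assoc (GSet U G) F H K = Arrow (TensO (GSet U G) (TensO (GSet U G) F H) K)
     (TensO (GSet U G) F (TensO (GSet U G) H K))
     (\<lambda>x\<in>Obj G. Assoc (Set_moncat U) (FObj F x) (FObj H x) (FObj K x))"
  "LUnit (GSet U G) F = Arrow (TensO (GSet U G) (Unit (GSet U G)) F) F
     (\<lambda>x\<in>Obj G. LUnit (Set_moncat U) (FObj F x))"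
  "RUnit (GSet U G) F = Arrow (TensO (GSet U G) F (Unit (GSet U G))) F
     (\<lambda>x\<in>Obj G. RUnit (Set_moncat U) (FObj F x))"
  "Braid (GSet U G) F H = Arrow (TensO (GSet U G) F H) (TensO (GSet U G) H F)
     (\<lambda>x\<in>Obj G. Braid (Set_moncat U) (FObj F x) (FObj H x))"
  by (simp_all add: GSet_def fun_moncat_def Let_def)

lemma Hom_GSet: "Hom (GSet U G) F H = Hom (fun_cat G (Set_moncat U)) F H"
  by (simp add: Hom_def GSet_def fun_moncat_def Let_def)

lemma category_GSet: "category G \<Longrightarrow> category (GSet U G)"
  using category_fun_cat[of G "Set_moncat U"] category_Set_moncat[of U]
  by (simp add: category_def GSet_def fun_moncat_def Let_def Hom_def)

lemma GSet_disc_Obj_iff: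
  "is_functor (disc X) (Set_moncat U) F \<longleftrightarrow>
    FObj F \<in> X \<rightarrow>\<^sub>E {Y. small U Y} \<and>
    FArr F = (\<lambda>x\<in>X. set_map (FObj F x) (FObj F x) (\<lambda>y. y))"
  by (simp add: is_functor_disc_iff[OF category_Set_moncat])

lemma Hom_GSet_disc:
  "\<alpha> \<in> Hom (GSet U (disc X)) F H \<longleftrightarrow>
     is_functor (disc X) (Set_moncat U) F \<and> is_functor (disc X) (Set_moncat U) H \<and>
     source \<alpha> = F \<and> target \<alpha> = H \<and> under \<alpha> \<in> extensional X \<and>
     (\<forall>x\<in>X. under \<alpha> x \<in> Hom (set_cat U) (FObj F x) (FObj H x))"
  using nat_trans_disc_iff[OF category_Set_moncat, of X U]
  by (auto simp: Hom_GSet Hom_fun_cat)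

lemma FObj_tensor_func_disc [simp]:
  "x \<in> X \<Longrightarrow> FObj (tensor_func (disc X) (Set_moncat U) F G) x = utimes (FObj F x) (FObj G x)"
  by (simp add: tensor_func_def)

lemma FObj_unit_func_disc [simp]:
  "x \<in> X \<Longrightarrow> FObj (unit_func (disc X) (Set_moncat U)) x = upoint"
  by (simp add: unit_func_def)

definition disc_family :: "'u set \<Rightarrow> ('u \<Rightarrow> 'u set) \<Rightarrow> 'u gset" where
  "disc_family X Y = \<lparr>FObj = restrict Y X, FArr = (\<lambda>x\<in>X. set_map (Y x) (Y x) (\<lambda>y. y))\<rparr>"

lemma FObj_disc_family [simp]: "x \<in> X \<Longrightarrow> FObj (disc_family X Y) x = Y x"
  by (simp add: disc_family_def)

lemma is_functor_disc_family:
  "(\<And>x. x \<in> X \<Longrightarrow> small U (Y x)) \<Longrightarrow> is_functor (disc X) (Set_moncat U) (disc_family X Y)"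
  by (auto simp: GSet_disc_Obj_iff disc_family_def)

context
  fixes U :: "'u itself"
  assumes inacc: "inaccessible U"
begin

lemma small_upoint: "small U (upoint :: 'u set)"
  by (simp add: upoint_def small_finite[OF inacc])

lemma utimesE:
  assumes "z \<in> utimes X (Y :: 'u set)"
  obtains "ufst z \<in> X" "usnd z \<in> Y" "upair (ufst z, usnd z) = z"
  using assms unfolding utimes_def by (auto simp: ufst_upair[OF inacc] usnd_upair[OF inacc])

lemma upair_in_utimes: "x \<in> X \<Longrightarrow> y \<in> Y \<Longrightarrow> upair (x, y) \<in> utimes X (Y :: 'u set)"
  by (simp add: utimes_def)

text \<open>
  The structure maps of sets, and then of families of sets, are only needed to be arrows with the
  right source and target: all equations between them will be mapped to a poset, where they hold
  automatically.
\<close>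

lemma Set_TensA_in_Hom:
  fixes X :: "'u set"
  assumes "f \<in> Hom (set_cat U) X X'" "g \<in> Hom (set_cat U) Y Y'"
  shows "TensA (Set_moncat U) f g \<in> Hom (set_cat U) (utimes X Y) (utimes X' Y')"
  using assms unfolding Set_moncat_def
  by (auto simp: Hom_set_cat small_utimes[OF inacc] intro!: upair_in_utimes elim!: utimesE)

lemma Set_TensA_Idt:
  "TensA (Set_moncat U) (set_map X X (\<lambda>x. x)) (set_map Y Y (\<lambda>x. x))
    = set_map (utimes X Y) (utimes X Y) (\<lambda>z :: 'u. z)"
  unfolding Set_moncat_def by (auto simp: set_map_def intro!: restrict_ext elim!: utimesE)

lemma Set_Assoc_in_Hom:
  "small U X \<Longrightarrow> small U Y \<Longrightarrow> small U Z \<Longrightarrow> Assoc (Set_moncat U) X Y Z \<in>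
    Hom (set_cat U) (utimes (utimes X Y) (Z :: 'u set)) (utimes X (utimes Y Z))"
  unfolding Set_moncat_def
  by (auto intro!: set_map_in_Hom small_utimes[OF inacc] upair_in_utimes elim!: utimesE)

lemma Set_LUnit_in_Hom:
  "small U X \<Longrightarrow> LUnit (Set_moncat U) X \<in> Hom (set_cat U) (utimes upoint (X :: 'u set)) X"
  unfolding Set_moncat_def
  by (auto intro!: set_map_in_Hom small_utimes[OF inacc] small_upoint elim!: utimesE)

lemma Set_RUnit_in_Hom:
  "small U X \<Longrightarrow> RUnit (Set_moncat U) X \<in> Hom (set_cat U) (utimes (X :: 'u set) upoint) X"
  unfolding Set_moncat_def
  by (auto intro!: set_map_in_Hom small_utimes[OF inacc] small_upoint elim!: utimesE)

lemma Set_Braid_in_Hom: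
  "small U X \<Longrightarrow> small U Y \<Longrightarrow>
    Braid (Set_moncat U) X Y \<in> Hom (set_cat U) (utimes X (Y :: 'u set)) (utimes Y X)"
  unfolding Set_moncat_def
  by (auto intro!: set_map_in_Hom small_utimes[OF inacc] upair_in_utimes elim!: utimesE)

abbreviation GX :: "'u set \<Rightarrow> ('u gset, 'u gset_map) moncat" where
  "GX X \<equiv> GSet U (disc X)"

lemma GSet_TensO_in_Obj:
  "F \<in> Obj (GX X) \<Longrightarrow> G \<in> Obj (GX X) \<Longrightarrow> TensO (GX X) F G \<in> Obj (GX X)"
  by (auto simp: GSet_disc_Obj_iff tensor_func_def small_utimes[OF inacc] Set_TensA_Idt PiE_iff
      intro!: restrict_ext)

lemma GSet_Unit_in_Obj: "Unit (GX X) \<in> Obj (GX X)"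
  by (auto simp: GSet_disc_Obj_iff unit_func_def small_upoint)

lemma GSet_TensA_in_Hom:
  assumes "\<alpha> \<in> Hom (GX X) F F'" "\<beta> \<in> Hom (GX X) G G'"
  shows "TensA (GX X) \<alpha> \<beta> \<in> Hom (GX X) (TensO (GX X) F G) (TensO (GX X) F' G')"
proof -
  have "TensO (GX X) F G \<in> Obj (GX X)" "TensO (GX X) F' G' \<in> Obj (GX X)"
    using assms by (auto simp: Hom_GSet_disc intro!: GSet_TensO_in_Obj[simplified])
  then show ?thesis
    using assms unfolding Hom_GSet_disc GSet_structure by (auto simp: Set_TensA_in_Hom)
qed

lemma GSet_Assoc_in_Hom:
  assumes "F \<in> Obj (GX X)" "G \<in> Obj (GX X)" "H \<in> Obj (GX X)"
  shows "Assoc (GX X) F G H \<in>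
    Hom (GX X) (TensO (GX X) (TensO (GX X) F G) H) (TensO (GX X) F (TensO (GX X) G H))"
proof -
  have "TensO (GX X) (TensO (GX X) F G) H \<in> Obj (GX X)" "TensO (GX X) F (TensO (GX X) G H) \<in> Obj (GX X)"
    using assms GSet_TensO_in_Obj by blast+
  then show ?thesis
    using assms unfolding Hom_GSet_disc
    by (simp add: GSet_structure Set_Assoc_in_Hom GSet_disc_Obj_iff PiE_iff)
qed

lemma GSet_LUnit_in_Hom:
  assumes "F \<in> Obj (GX X)"
  shows "LUnit (GX X) F \<in> Hom (GX X) (TensO (GX X) (Unit (GX X)) F) F"
proof -
  have "TensO (GX X) (Unit (GX X)) F \<in> Obj (GX X)"
    using assms by (intro GSet_TensO_in_Obj GSet_Unit_in_Obj)
  then show ?thesis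
    using assms unfolding Hom_GSet_disc
    by (simp add: GSet_structure Set_LUnit_in_Hom GSet_disc_Obj_iff PiE_iff)
qed

lemma GSet_RUnit_in_Hom:
  assumes "F \<in> Obj (GX X)"
  shows "RUnit (GX X) F \<in> Hom (GX X) (TensO (GX X) F (Unit (GX X))) F"
proof -
  have "TensO (GX X) F (Unit (GX X)) \<in> Obj (GX X)"
    using assms by (intro GSet_TensO_in_Obj GSet_Unit_in_Obj)
  then show ?thesis
    using assms unfolding Hom_GSet_disc
    by (simp add: GSet_structure Set_RUnit_in_Hom GSet_disc_Obj_iff PiE_iff)
qed

lemma GSet_Braid_in_Hom:
  assumes "F \<in> Obj (GX X)" "G \<in> Obj (GX X)"
  shows "Braid (GX X) F G \<in> Hom (GX X) (TensO (GX X) F G) (TensO (GX X) G F)"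
proof -
  have "TensO (GX X) F G \<in> Obj (GX X)" "TensO (GX X) G F \<in> Obj (GX X)"
    using assms GSet_TensO_in_Obj by blast+
  then show ?thesis
    using assms unfolding Hom_GSet_disc
    by (simp add: GSet_structure Set_Braid_in_Hom GSet_disc_Obj_iff PiE_iff)
qed

end

section \<open>Colimits of families of sets\<close>

lemma cocone_image:
  assumes J: "category J" and D: "is_functor J C D" and F: "is_functor C E F"
    and c: "cocone J C D c \<iota>"
  shows "cocone J E (comp_func J F D) (FObj F c) (\<lambda>j. FArr F (\<iota> j))"
  unfolding cocone_def
proof (intro conjI ballI)
  have c': "c \<in> Obj C" "\<And>j. j \<in> Obj J \<Longrightarrow> \<iota> j \<in> Hom C (FObj D j) c"
    "\<And>k. k \<in> Arr J \<Longrightarrow> Comp C (\<iota> (Cod J k)) (FArr D k) = \<iota> (Dom J k)"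
    using c by (auto simp: cocone_def)
  note F' = is_functorD[OF F] and D' = is_functorD[OF D]
  show "FObj F c \<in> Obj E" using F'(1)[OF c'(1)] .
  fix j assume "j \<in> Obj J"
  then show "FArr F (\<iota> j) \<in> Hom E (FObj (comp_func J F D) j) (FObj F c)"
    using F'(2)[OF c'(2)] by (simp add: comp_func_def compose_def)
next
  have c': "\<And>j. j \<in> Obj J \<Longrightarrow> \<iota> j \<in> Hom C (FObj D j) c"
    "\<And>k. k \<in> Arr J \<Longrightarrow> Comp C (\<iota> (Cod J k)) (FArr D k) = \<iota> (Dom J k)"
    using c by (auto simp: cocone_def)
  fix k assume k: "k \<in> Arr J"
  then have k': "k \<in> Hom J (Dom J k) (Cod J k)" by (simp add: Hom_def)
  show "Comp E (FArr F (\<iota> (Cod J k))) (FArr (comp_func J F D) k) = FArr F (\<iota> (Dom J k))"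
    using is_functorD(4)[OF F is_functorD(2)[OF D k'] c'(1)[OF Cod_in_Obj[OF J k]]] c'(2)[OF k] k
    by (simp add: comp_func_def compose_def)
qed

lemma category_poset_cat:
  assumes "r \<subseteq> A \<times> A" "partial_order_on A r"
  shows "category (poset_cat A r)"
  using assms unfolding category_def Hom_def poset_cat_def partial_order_on_def preorder_on_def
  by (auto simp: refl_on_def dest: transD)

lemma is_functor_hom_func:
  assumes C: "category C" and small: "locally_small U C" and x: "x \<in> Obj C"
  shows "is_functor C (set_cat U) (hom_func C x)"
proof -
  have s: "small U (Hom C x y)" if "y \<in> Obj C" for y
    using small x that by (simp add: locally_small_def)
  have m: "set_map (Hom C x y) (Hom C x z) (\<lambda>g. Comp C f g) \<in> Hom (set_cat U) (Hom C x y) (Hom C x z)"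
    if "f \<in> Hom C y z" for f y z
    using Comp_in_Hom[OF C _ that] Hom_in_Obj[OF C that] s by (auto intro!: set_map_in_Hom)
  have h: "f \<in> Hom C (Dom C f) (Cod C f)" if "f \<in> Arr C" for f using that by (simp add: Hom_def)
  show ?thesis
    unfolding is_functor_def
  proof (intro conjI ballI impI)
    fix f assume f: "f \<in> Arr C"
    then show "FArr (hom_func C x) f \<in>
        Hom (set_cat U) (FObj (hom_func C x) (Dom C f)) (FObj (hom_func C x) (Cod C f))"
      using m[OF h[OF f]] Dom_in_Obj[OF C f] Cod_in_Obj[OF C f] by (simp add: hom_func_def)
  next
    fix y assume y: "y \<in> Obj C"
    then have "Idt C y \<in> Hom C y y" using Idt_in_Hom[OF C] by simp
    then show "FArr (hom_func C x) (Idt C y) = Idt (set_cat U) (FObj (hom_func C x) y)"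
      using y Idt_Comp[OF C] by (auto simp: hom_func_def Hom_def set_map_def intro!: restrict_ext)
  next
    fix f g assume f: "f \<in> Arr C" and g: "g \<in> Arr C" and fg: "Cod C f = Dom C g"
    have g': "g \<in> Hom C (Cod C f) (Cod C g)" using g fg by (simp add: Hom_def)
    have gf: "Comp C g f \<in> Hom C (Dom C f) (Cod C g)" by (rule Comp_in_Hom[OF C h[OF f] g'])
    have "Comp C f a \<in> Hom C x (Cod C f)" "Comp C (Comp C g f) a = Comp C g (Comp C f a)"
      if "a \<in> Hom C x (Dom C f)" for a
      using Comp_in_Hom[OF C that h[OF f]] Comp_assoc[OF C that h[OF f] g'] by simp_all
    then show "FArr (hom_func C x) (Comp C g f) =
        Comp (set_cat U) (FArr (hom_func C x) g) (FArr (hom_func C x) f)"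
      using f g gf fg HomD[OF gf] by (auto simp: hom_func_def set_map_def intro!: restrict_ext)
  qed (use s in \<open>auto simp: hom_func_def\<close>)
qed

lemma cocone_Comp:
  assumes C: "category C" and J: "category J" and D: "is_functor J C D"
    and c: "cocone J C D c \<iota>" and h: "h \<in> Hom C c d"
  shows "cocone J C D d (\<lambda>j. Comp C h (\<iota> j))"
proof -
  have \<iota>: "\<And>j. j \<in> Obj J \<Longrightarrow> \<iota> j \<in> Hom C (FObj D j) c"
    and nat: "\<And>k. k \<in> Arr J \<Longrightarrow> Comp C (\<iota> (Cod J k)) (FArr D k) = \<iota> (Dom J k)"
    using c by (auto simp: cocone_def)
  have "Comp C (Comp C h (\<iota> (Cod J k))) (FArr D k) = Comp C h (\<iota> (Dom J k))" if "k \<in> Arr J" for k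
  proof -
    have k: "k \<in> Hom J (Dom J k) (Cod J k)" using that by (simp add: Hom_def)
    show ?thesis
      using Comp_assoc[OF C is_functorD(2)[OF D k] \<iota>[OF Cod_in_Obj[OF J that]] h] nat[OF that] by simp
  qed
  then show ?thesis
    unfolding cocone_def using Hom_in_Obj[OF C h] Comp_in_Hom[OF C \<iota> h] by auto
qed

text \<open>
  If all families of a diagram are empty at \<open>a\<close>, then two maps from the colimit \<open>c\<close> to a constant
  two-element family that differ only at \<open>a\<close> agree on the diagram. By uniqueness they are equal,
  so \<open>c\<close> is empty at \<open>a\<close>. This avoids constructing colimits of families.
\<close>

lemma GSet_disc_colimit_covers:
  fixes U :: "'u itself"
  assumes inacc: "inaccessible U" and J: "category J" and D: "is_functor J (GSet U (disc X)) D"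
    and c: "is_colimit J (GSet U (disc X)) D c \<iota>" and a: "a \<in> X" and y: "y \<in> FObj c a"
  shows "\<exists>j\<in>Obj J. FObj (FObj D j) a \<noteq> {}"
proof (rule ccontr)
  assume "\<not> ?thesis"
  then have empty: "\<And>j. j \<in> Obj J \<Longrightarrow> FObj (FObj D j) a = {}" by blast
  let ?C = "GSet U (disc X)"
  have C: "category ?C" by (rule category_GSet[OF category_disc])
  obtain t f :: 'u where tf: "t \<noteq> f" using two_elements[OF inacc] .
  define two where "two = disc_family X (\<lambda>_. {t, f})"
  have co: "cocone J ?C D c \<iota>" using c by (simp add: is_colimit_def)
  then have cO: "is_functor (disc X) (Set_moncat U) c" by (simp add: cocone_def)
  have two: "is_functor (disc X) (Set_moncat U) two"
    unfolding two_def by (rule is_functor_disc_family) (simp add: small_finite[OF inacc])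
  \<comment> \<open>The indicator of \<open>a\<close> if \<open>b\<close> holds, and otherwise the constant map.\<close>
  define h where "h b = Arrow c two
      (\<lambda>x\<in>X. set_map (FObj c x) {t, f} (\<lambda>_. if b \<and> x = a then t else f))" for b
  have h: "h b \<in> Hom ?C c two" for b
    using cO two unfolding Hom_GSet_disc h_def
    by (auto simp: two_def GSet_disc_Obj_iff PiE_iff small_finite[OF inacc] intro!: set_map_in_Hom)
  have eq: "Comp ?C (h True) (\<iota> j) = Comp ?C (h False) (\<iota> j)" if j: "j \<in> Obj J" for j
  proof -
    have "\<iota> j \<in> Hom ?C (FObj D j) c" using co j by (simp add: cocone_def)
    then have "source (under (\<iota> j) x) = FObj (FObj D j) x" if "x \<in> X" for x
      using that by (auto simp: Hom_GSet_disc Hom_set_cat)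
    then show ?thesis
      using empty[OF j] by (auto simp: vcomp_def h_def set_map_def intro!: restrict_ext)
  qed
  have "cocone J ?C D two (\<lambda>j. Comp ?C (h False) (\<iota> j))"
    by (rule cocone_Comp[OF C J D co h])
  then have "\<exists>!k. k \<in> Hom ?C c two \<and> (\<forall>j\<in>Obj J. Comp ?C k (\<iota> j) = Comp ?C (h False) (\<iota> j))"
    using c unfolding is_colimit_def by blast
  then have "h True = h False"
    using h eq by (metis (no_types, lifting))
  then have "under (under (h True) a) y = under (under (h False) a) y" by simp
  then show False using tf a y by (simp add: h_def)
qed

text \<open>
  The family \<open>\<delta> t\<close> with a single point at \<open>t\<close>, that is the functor represented by \<open>t\<close>.
\<close>

definition point_at :: "'u set \<Rightarrow> 'u \<Rightarrow> 'u gset" where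
  "point_at X t = disc_family X (\<lambda>x. if x = t then upoint else {})"

lemma FObj_point_at [simp]: "x \<in> X \<Longrightarrow> FObj (point_at X t) x = (if x = t then upoint else {})"
  by (simp add: point_at_def)

definition points_diagram :: "'u itself \<Rightarrow> 'u set \<Rightarrow> ('u, 'u, 'u gset, 'u gset_map) func" where
  "points_diagram U X =
     \<lparr>FObj = (\<lambda>t\<in>X. point_at X t), FArr = (\<lambda>t\<in>X. Idt (GSet U (disc X)) (point_at X t))\<rparr>"

context
  fixes U :: "'u itself"
  assumes inacc: "inaccessible U"
begin

lemma is_functor_point_at: "is_functor (disc X) (Set_moncat U) (point_at X t)"
  unfolding point_at_def
  by (rule is_functor_disc_family) (simp add: small_finite[OF inacc] upoint_def)

lemma is_functor_points_diagram: "is_functor (disc X) (GSet U (disc X)) (points_diagram U X)"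
  by (auto simp: is_functor_disc_iff[OF category_GSet[OF category_disc]] points_diagram_def
      is_functor_point_at)

text \<open>
  The unit has one point over every \<open>t \<in> X\<close>, so it is the disjoint union of the representables:
  a compatible family of maps \<open>\<mu> t\<close> out of the \<open>\<delta> t\<close> amounts to one element over each \<open>t\<close>.
\<close>

lemma unit_is_colimit_of_points:
  "\<exists>\<iota>. is_colimit (disc X) (GSet U (disc X)) (points_diagram U X) (Unit (GSet U (disc X))) \<iota>"
proof -
  let ?C = "GSet U (disc X)" and ?D = "points_diagram U X"
  have C: "category ?C" by (rule category_GSet[OF category_disc])
  have unit: "is_functor (disc X) (Set_moncat U) (Unit ?C)"
    using GSet_Unit_in_Obj[OF inacc] by simp
  define \<iota> where "\<iota> t = Arrow (point_at X t) (Unit ?C)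
      (\<lambda>x\<in>X. set_map (FObj (point_at X t) x) upoint (\<lambda>y. y))" for t
  have \<iota>: "\<iota> t \<in> Hom ?C (point_at X t) (Unit ?C)" for t
    using unit is_functor_point_at unfolding Hom_GSet_disc \<iota>_def
    by (auto simp: small_upoint[OF inacc] small_finite[OF inacc] intro!: set_map_in_Hom)
  have "cocone (disc X) ?C ?D (Unit ?C) \<iota>"
    unfolding cocone_def
    using \<iota> Comp_Idt[OF C \<iota>] unit by (auto simp: points_diagram_def simp del: GSet_simps(4,5))
  moreover have "\<exists>!h. h \<in> Hom ?C (Unit ?C) d \<and> (\<forall>t\<in>Obj (disc X). Comp ?C h (\<iota> t) = \<mu> t)"
    if d: "cocone (disc X) ?C ?D d \<mu>" for d \<mu>
  proof -
    have \<mu>: "\<mu> t \<in> Hom ?C (point_at X t) d" if "t \<in> X" for t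
      using d that unfolding cocone_def by (auto simp: points_diagram_def)
    have dO: "is_functor (disc X) (Set_moncat U) d" using d by (simp add: cocone_def)
    have \<mu>x: "under (\<mu> t) x \<in> Hom (set_cat U) (if x = t then upoint else {}) (FObj d x)"
      if "t \<in> X" "x \<in> X" for t x
      using \<mu>[OF that(1)] that(2) by (simp add: Hom_GSet_disc)
    define h where "h = Arrow (Unit ?C) d (\<lambda>x\<in>X. under (\<mu> x) x)"
    have h: "h \<in> Hom ?C (Unit ?C) d"
      using unit dO \<mu>x unfolding Hom_GSet_disc h_def by fastforce
    show ?thesis
    proof (rule ex1I[of _ h], intro conjI ballI h)
      fix t assume "t \<in> Obj (disc X)"
      then have t: "t \<in> X" by simp
      have "(\<lambda>x\<in>X. Comp (set_cat U) (under h x) (under (\<iota> t) x)) = under (\<mu> t)"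
      proof (rule extensionalityI[of _ X])
        fix x assume x: "x \<in> X"
        have hx: "under h x \<in> Hom (set_cat U) upoint (FObj d x)"
          and ix: "under (\<iota> t) x \<in> Hom (set_cat U) (if x = t then upoint else {}) upoint"
          using h \<iota>[of t] x by (auto simp: Hom_GSet_disc split: if_splits)
        have "Comp (set_cat U) (under h x) (under (\<iota> t) x) = under (\<mu> t) x"
          by (rule set_arrow_eqI[OF Comp_in_Hom[OF category_set_cat ix hx] \<mu>x[OF t x]])
            (use x in \<open>auto simp: h_def \<iota>_def split: if_splits\<close>)
        then show "(\<lambda>x\<in>X. Comp (set_cat U) (under h x) (under (\<iota> t) x)) x = under (\<mu> t) x"
          using x by simp
      qed (use \<mu>[OF t] in \<open>auto simp: Hom_GSet_disc\<close>)
      then show "Comp ?C h (\<iota> t) = \<mu> t"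
        using \<mu>[OF t] by (cases "\<mu> t") (simp add: vcomp_def h_def \<iota>_def Hom_GSet_disc)
    next
      fix k assume k: "k \<in> Hom ?C (Unit ?C) d \<and> (\<forall>t\<in>Obj (disc X). Comp ?C k (\<iota> t) = \<mu> t)"
      have "under k = under h"
      proof (rule extensionalityI[of _ X])
        fix x assume x: "x \<in> X"
        have kx: "under k x \<in> Hom (set_cat U) upoint (FObj d x)"
          and hx: "under h x \<in> Hom (set_cat U) upoint (FObj d x)"
          using k h x by (auto simp: Hom_GSet_disc)
        have "\<mu> x = Comp ?C k (\<iota> x)" using k x by simp
        then have "under (\<mu> x) x = Comp (set_cat U) (under k x) (under (\<iota> x) x)"
          using x by (simp add: vcomp_def)
        then show "under k x = under h x"
          by (intro set_arrow_eqI[OF kx hx]) (use x in \<open>auto simp: h_def \<iota>_def\<close>)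
      qed (use k h in \<open>auto simp: Hom_GSet_disc\<close>)
      then show "k = h"
        using k h by (intro arrow.expand) (auto simp: Hom_GSet_disc)
    qed
  qed
  ultimately show ?thesis unfolding is_colimit_def by blast
qed

end

section \<open>The open sets of a space as a commutative 2-ring\<close>

text \<open>
  All 2-rings in \<^const>\<open>TwoSpecSet\<close> have the same type of objects, so an open set has to be stored
  in a value of that type. The value is a mere container and not a functor.
\<close>

definition code :: "'u set \<Rightarrow> 'u gset" where
  "code V = \<lparr>FObj = (\<lambda>_. V), FArr = undefined\<rparr>"

definition pts :: "'u gset \<Rightarrow> 'u set" where
  "pts a = FObj a undefined"

lemma pts_code [simp]: "pts (code V) = V"
  by (simp add: code_def pts_def)

lemma code_inject [simp]: "code V = code W \<longleftrightarrow> V = W"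
  by (metis pts_code)

text \<open>
  The underlying map of an arrow carries no information and is set to a default value, so that
  parallel arrows are equal.
\<close>

definition opens_ring :: "'u set set \<Rightarrow> ('u gset, 'u gset_map) moncat" where
  "opens_ring \<O> =
     (let meet = (\<lambda>a b. code (pts a \<inter> pts b)); incl = (\<lambda>a b. Arrow a b undefined) in
      \<lparr>Obj = code ` \<O>, Arr = {incl (code V) (code W) | V W. V \<in> \<O> \<and> W \<in> \<O> \<and> V \<subseteq> W},
       Dom = source, Cod = target,
       Idt = (\<lambda>a. incl a a), Comp = (\<lambda>g f. incl (source f) (target g)),
       TensO = meet, TensA = (\<lambda>f g. incl (meet (source f) (source g)) (meet (target f) (target g))),
       Unit = code (\<Union>\<O>),
       Assoc = (\<lambda>a b c. incl (meet (meet a b) c) (meet a (meet b c))),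
       LUnit = (\<lambda>a. incl (meet (code (\<Union>\<O>)) a) a), RUnit = (\<lambda>a. incl (meet a (code (\<Union>\<O>))) a),
       Braid = (\<lambda>a b. incl (meet a b) (meet b a))\<rparr>)"

lemma opens_ring_simps [simp]:
  "Obj (opens_ring \<O>) = code ` \<O>" "Dom (opens_ring \<O>) = source" "Cod (opens_ring \<O>) = target"
  "Idt (opens_ring \<O>) a = Arrow a a undefined"
  "Comp (opens_ring \<O>) g f = Arrow (source f) (target g) undefined"
  "TensO (opens_ring \<O>) a b = code (pts a \<inter> pts b)"
  "TensA (opens_ring \<O>) f g =
     Arrow (code (pts (source f) \<inter> pts (source g))) (code (pts (target f) \<inter> pts (target g))) undefined"
  "Unit (opens_ring \<O>) = code (\<Union>\<O>)"
  "Assoc (opens_ring \<O>) a b c =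
     Arrow (code (pts a \<inter> pts b \<inter> pts c)) (code (pts a \<inter> (pts b \<inter> pts c))) undefined"
  "LUnit (opens_ring \<O>) a = Arrow (code (\<Union>\<O> \<inter> pts a)) a undefined"
  "RUnit (opens_ring \<O>) a = Arrow (code (pts a \<inter> \<Union>\<O>)) a undefined"
  "Braid (opens_ring \<O>) a b = Arrow (code (pts a \<inter> pts b)) (code (pts b \<inter> pts a)) undefined"
  by (simp_all add: opens_ring_def Let_def)

lemma Hom_opens_ring:
  "f \<in> Hom (opens_ring \<O>) a b \<longleftrightarrow>
     a \<in> code ` \<O> \<and> b \<in> code ` \<O> \<and> pts a \<subseteq> pts b \<and> f = Arrow a b undefined"
  unfolding Hom_def opens_ring_def Let_def by auto

lemma Arr_opens_ring: "f \<in> Arr (opens_ring \<O>) \<longleftrightarrow> f \<in> Hom (opens_ring \<O>) (source f) (target f)"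
  by (simp add: Hom_def)

lemma opens_ring_eqI: "pts a = pts b \<Longrightarrow> a \<in> code ` \<O> \<Longrightarrow> b \<in> code ` \<O> \<Longrightarrow> a = b"
  by auto

text \<open>
  The underlying space is the largest open set \<open>\<Union>\<O>\<close>.
\<close>

locale small_topology =
  fixes U :: "'u itself" and \<O> :: "'u set set"
  assumes inacc: "inaccessible U" and small_opens: "small U \<O>"
    and Union_open: "\<And>S. S \<subseteq> \<O> \<Longrightarrow> \<Union>S \<in> \<O>"
    and Int_open: "\<And>V W. V \<in> \<O> \<Longrightarrow> W \<in> \<O> \<Longrightarrow> V \<inter> W \<in> \<O>"
begin

abbreviation "T \<equiv> opens_ring \<O>"

lemma category_opens: "category T"
  by (rule categoryI) (auto simp: Hom_opens_ring Arr_opens_ring)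

lemma Hom_opens_cases: "Hom T a b = {} \<or> Hom T a b = {Arrow a b undefined}"
  by (auto simp: Hom_opens_ring)

lemma locally_small_opens: "locally_small U T"
  unfolding locally_small_def using Hom_opens_cases small_finite[OF inacc]
  by (metis finite.emptyI finite.insertI)

lemma symmetric_monoidal_opens: "symmetric_monoidal T"
proof -
  have top: "\<Union>\<O> \<in> \<O>" by (rule Union_open) simp
  have top_Int: "\<Union>\<O> \<inter> V = V" "V \<inter> \<Union>\<O> = V" if "V \<in> \<O>" for V
    using that by auto
  have iso: "is_iso T (Arrow (code V) (code V) undefined)" if "V \<in> \<O>" for V
    using that Idt_is_iso[OF category_opens, of "code V"] by simp
  have "tensor_bifunctor T"
    unfolding tensor_bifunctor_def
    by (auto simp: Hom_opens_ring Arr_opens_ring Int_open)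
  moreover have "constraints_natural T"
    unfolding constraints_natural_def
    by (auto simp: Hom_opens_ring Arr_opens_ring Int_open top top_Int Int_ac iso)
  moreover have "constraints_coherent T"
    unfolding constraints_coherent_def
    by (auto simp: top_Int Int_ac)
  ultimately show ?thesis
    unfolding symmetric_monoidal_def using category_opens top by simp
qed

lemma is_functor_into_opens_arr:
  assumes "is_functor J T D" "k \<in> Arr J"
  shows "FArr D k = Arrow (FObj D (Dom J k)) (FObj D (Cod J k)) undefined"
    and "pts (FObj D (Dom J k)) \<subseteq> pts (FObj D (Cod J k))"
  using is_functorD(2)[OF assms(1), of k "Dom J k" "Cod J k"] assms(2)
  by (auto simp: Hom_opens_ring Hom_def[of J])

lemma cocone_opens_iff:
  assumes J: "category J" and D: "is_functor J T D"
  shows "cocone J T D c \<iota> \<longleftrightarrow> c \<in> Obj T \<and>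
    (\<forall>j\<in>Obj J. pts (FObj D j) \<subseteq> pts c \<and> \<iota> j = Arrow (FObj D j) c undefined)"
  using is_functorD(1)[OF D] is_functor_into_opens_arr[OF D] Dom_in_Obj[OF J] Cod_in_Obj[OF J]
  unfolding cocone_def by (auto simp: Hom_opens_ring)

text \<open>
  Colimits in a poset are joins, and joins of open sets are unions.
\<close>

lemma is_colimit_opens_iff:
  assumes J: "category J" and D: "is_functor J T D"
  shows "is_colimit J T D c \<iota> \<longleftrightarrow>
    cocone J T D c \<iota> \<and> pts c = (\<Union>j\<in>Obj J. pts (FObj D j))" (is "?L \<longleftrightarrow> ?R")
proof
  let ?V = "\<Union>j\<in>Obj J. pts (FObj D j)"
  have open': "pts (FObj D j) \<in> \<O>" if "j \<in> Obj J" for j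
    using is_functorD(1)[OF D that] by auto
  have V: "?V \<in> \<O>" using Union_open[of "(\<lambda>j. pts (FObj D j)) ` Obj J"] open' by auto
  assume L: ?L
  then have c: "cocone J T D c \<iota>" by (simp add: is_colimit_def)
  have "cocone J T D (code ?V) (\<lambda>j. Arrow (FObj D j) (code ?V) undefined)"
    using V unfolding cocone_opens_iff[OF J D] by auto
  then obtain h where "h \<in> Hom T c (code ?V)"
    using L unfolding is_colimit_def by blast
  then have "pts c \<subseteq> ?V" by (simp add: Hom_opens_ring)
  then show ?R using c unfolding cocone_opens_iff[OF J D] by auto
next
  assume R: ?R
  show ?L
    unfolding is_colimit_def
  proof (intro conjI allI impI)
    fix d \<mu> assume d: "cocone J T D d \<mu>"
    then have "Arrow c d undefined \<in> Hom T c d"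
      using R unfolding cocone_opens_iff[OF J D] by (auto simp: Hom_opens_ring)
    moreover have "Comp T (Arrow c d undefined) (\<iota> j) = \<mu> j" if "j \<in> Obj J" for j
      using R d that unfolding cocone_opens_iff[OF J D] by auto
    ultimately show "\<exists>!h. h \<in> Hom T c d \<and> (\<forall>j\<in>Obj J. Comp T h (\<iota> j) = \<mu> j)"
      by (intro ex1I[of _ "Arrow c d undefined"]) (auto simp: Hom_opens_ring)
  qed (use R in simp)
qed

text \<open>
  Only one inclusion has to be checked: functoriality makes the value at a colimit an upper bound.
\<close>

lemma preserves_colimit_into_opens:
  assumes J: "category J" and D: "is_functor J C D" and F: "is_functor C T F"
    and sub: "\<And>c \<iota>. is_colimit J C D c \<iota> \<Longrightarrow> pts (FObj F c) \<subseteq> (\<Union>j\<in>Obj J. pts (FObj F (FObj D j)))"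
  shows "preserves_colimit J D C T F"
  unfolding preserves_colimit_def
proof (intro allI impI)
  fix c \<iota> assume c: "is_colimit J C D c \<iota>"
  note JT = is_functor_comp_func[OF J D F]
  have FD: "FObj (comp_func J F D) j = FObj F (FObj D j)" if "j \<in> Obj J" for j
    using that by (simp add: comp_func_def compose_def)
  have co: "cocone J T (comp_func J F D) (FObj F c) (\<lambda>j. FArr F (\<iota> j))"
    using cocone_image[OF J D F] c by (simp add: is_colimit_def)
  then show "is_colimit J T (comp_func J F D) (FObj F c) (\<lambda>j. FArr F (\<iota> j))"
    using sub[OF c] FD unfolding is_colimit_opens_iff[OF J JT] cocone_opens_iff[OF J JT] by auto
qed

lemma cocomplete_opens: "cocomplete U T"
  unfolding cocomplete_def
proof (intro allI impI)
  fix J :: "('u, 'u) cat" and D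
  assume "small_category U J \<and> is_functor J T D"
  then have J: "category J" and D: "is_functor J T D" by (auto simp: small_category_def)
  have "pts (FObj D j) \<in> \<O>" if "j \<in> Obj J" for j
    using is_functorD(1)[OF D that] by auto
  then have "(\<Union>j\<in>Obj J. pts (FObj D j)) \<in> \<O>"
    using Union_open[of "(\<lambda>j. pts (FObj D j)) ` Obj J"] by auto
  then show "\<exists>c \<iota>. is_colimit J T D c \<iota>"
    unfolding is_colimit_opens_iff[OF J D] cocone_opens_iff[OF J D]
    by (intro exI[of _ "code (\<Union>j\<in>Obj J. pts (FObj D j))"]
        exI[of _ "\<lambda>j. Arrow (FObj D j) (code (\<Union>j\<in>Obj J. pts (FObj D j))) undefined"]) auto
qed

text \<open>
  Let \<open>K\<close> be larger than the number of open sets. A \<open>K\<close>-directed diagram of open sets has at most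
  as many values as there are open sets, so some index \<open>u\<close> lies above a set of representatives of
  all values, and the colimit is the value at \<open>u\<close>. A colimit attained in this way is preserved by
  every hom-functor into sets, since hom-sets have at most one element.
\<close>

lemma little_opens:
  assumes x: "x \<in> Obj T"
  shows "little U T x"
proof -
  obtain K :: "'u set" where K: "small U K" "infinite K" "\<O> \<prec> K"
    using small_larger_cardinal[OF inacc small_opens] .
  have "preserves_colimit (poset_cat A r) D T (set_cat U) (hom_func T x)"
    if A: "small U A" "directed_poset K A r" and D: "is_functor (poset_cat A r) T D"
    for A :: "'u set" and r and D :: "('u, 'u \<times> 'u, 'u gset, 'u gset_map) func"
    unfolding preserves_colimit_def
  proof (intro allI impI)
    fix c \<iota> assume c: "is_colimit (poset_cat A r) T D c \<iota>"
    let ?J = "poset_cat A r" and ?H = "hom_func T x"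
    have dir: "\<And>X. X \<subseteq> A \<Longrightarrow> X \<prec> K \<Longrightarrow> \<exists>u\<in>A. \<forall>x\<in>X. (x, u) \<in> r"
      using A(2) by (simp add: directed_poset_def)
    have J: "category ?J" using A(2) by (auto simp: directed_poset_def intro: category_poset_cat)
    have Jsimp [simp]: "Obj ?J = A" "Arr ?J = r" "Dom ?J = fst" "Cod ?J = snd"
      by (simp_all add: poset_cat_def)
    note H = is_functor_hom_func[OF category_opens locally_small_opens x]
    have cc: "cocone ?J T D c \<iota>" and cpts: "pts c = (\<Union>j\<in>A. pts (FObj D j))"
      using c unfolding is_colimit_opens_iff[OF J D] by auto
    have cO: "c \<in> Obj T" and \<iota>: "\<And>j. j \<in> A \<Longrightarrow> \<iota> j = Arrow (FObj D j) c undefined"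
      using cc unfolding cocone_opens_iff[OF J D] by auto
    have DO: "FObj D j \<in> code ` \<O>" if "j \<in> A" for j
      using is_functorD(1)[OF D, of j] that by simp
    have mono: "pts (FObj D a) \<subseteq> pts (FObj D b)" if "(a, b) \<in> r" for a b
      using is_functor_into_opens_arr(2)[OF D, of "(a, b)"] that by simp
    \<comment> \<open>\<open>R\<close> contains one index for every value of the diagram, so it is smaller than \<open>K\<close>.\<close>
    obtain R where R: "R \<subseteq> A" "inj_on (FObj D) R" "FObj D ` A = FObj D ` R"
      using subset_image_inj[of "FObj D ` A" "FObj D" A] by blast
    have "R \<lesssim> \<O>"
    proof -
      have "FObj D ` R \<lesssim> code ` \<O>" using DO R(1) by (intro subset_imp_lepoll) auto
      then show ?thesis using R(2) image_lepoll[of code \<O>] by (meson inj_on_image_lepoll_1 lepoll_trans)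
    qed
    then obtain u where u: "u \<in> A" "\<forall>a\<in>R. (a, u) \<in> r"
      using dir[OF R(1)] lesspoll_trans1 K(3) by blast
    have "pts (FObj D j) \<subseteq> pts (FObj D u)" if j: "j \<in> A" for j
    proof -
      obtain a where "a \<in> R" "FObj D j = FObj D a" using R(3) j by blast
      then show ?thesis using mono u(2) by metis
    qed
    then have "pts c = pts (FObj D u)" using cpts u(1) by auto
    then have Du: "FObj D u = c" using opens_ring_eqI[OF _ cO[simplified] DO[OF u(1)]] by simp
    have FH: "FObj (comp_func ?J ?H D) j = Hom T x (FObj D j)" if "j \<in> A" for j
      using that DO by (simp add: comp_func_def compose_def hom_func_def)
    have AH: "FArr ?H (\<iota> j) = set_map (Hom T x (FObj D j)) (Hom T x c) (Comp T (\<iota> j))"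
      if "j \<in> A" for j
    proof -
      have "\<iota> j \<in> Arr T"
        using cc that by (auto simp: cocone_def Hom_def)
      then show ?thesis
        using \<iota>[OF that] by (auto simp: hom_func_def set_map_def intro!: restrict_ext)
    qed
    have co: "cocone ?J (set_cat U) (comp_func ?J ?H D) (FObj ?H c) (\<lambda>j. FArr ?H (\<iota> j))"
      by (rule cocone_image[OF J D H cc])
    have Hc: "FObj ?H c = Hom T x c" using cO by (simp add: hom_func_def)
    show "is_colimit ?J (set_cat U) (comp_func ?J ?H D) (FObj ?H c) (\<lambda>j. FArr ?H (\<iota> j))"
      unfolding is_colimit_def
    proof (intro conjI allI impI co)
      fix Z \<mu> assume Z: "cocone ?J (set_cat U) (comp_func ?J ?H D) Z \<mu>"
      have \<mu>: "\<mu> j \<in> Hom (set_cat U) (Hom T x (FObj D j)) Z" if "j \<in> A" for j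
      proof -
        have "\<mu> j \<in> Hom (set_cat U) (FObj (comp_func ?J ?H D) j) Z"
          using Z that Jsimp(1) unfolding cocone_def by blast
        then show ?thesis by (simp only: FH[OF that])
      qed
      have \<mu>r: "under (\<mu> a) g = under (\<mu> b) (Comp T (FArr D (a, b)) g)"
        if ab: "(a, b) \<in> r" "a \<in> A" "b \<in> A" and g: "g \<in> Hom T x (FObj D a)" for a b g
      proof -
        have k: "FArr D (a, b) \<in> Hom T (FObj D a) (FObj D b)"
          using is_functorD(2)[OF D, of "(a, b)" a b] ab by (simp add: Hom_def)
        have "Comp (set_cat U) (\<mu> b) (FArr (comp_func ?J ?H D) (a, b)) = \<mu> a"
          using Z ab(1) unfolding cocone_def by (metis Jsimp(2,3,4) fst_conv snd_conv)
        then have "under (\<mu> a) g = under (Comp (set_cat U) (\<mu> b) (FArr (comp_func ?J ?H D) (a, b))) g"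
          by simp
        also have "\<dots> = under (\<mu> b) (Comp T (FArr D (a, b)) g)"
          using k ab g by (auto simp: comp_func_def compose_def hom_func_def Hom_def[of T])
        finally show ?thesis .
      qed
      have \<mu>u: "\<mu> u \<in> Hom (set_cat U) (Hom T x c) Z" using \<mu>[OF u(1)] by (simp add: Du)
      \<comment> \<open>Along a common upper bound \<open>v\<close> of \<open>j\<close> and \<open>u\<close>, all elements have the same image in \<open>Z\<close>.\<close>
      have \<mu>_const: "under (\<mu> j) g = under (\<mu> u) (Arrow x c undefined)"
        if j: "j \<in> A" and g: "g \<in> Hom T x (FObj D j)" for j g
      proof -
        have "{j, u} \<prec> K" by (rule finite_lesspoll_infinite[OF K(2)]) simp
        then obtain v where v: "v \<in> A" "(j, v) \<in> r" "(u, v) \<in> r" using dir[of "{j, u}"] j u(1) by auto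
        have "Arrow x c undefined \<in> Hom T x (FObj D u)"
          using g x cO cpts j Du by (auto simp: Hom_opens_ring)
        then show ?thesis
          using \<mu>r[OF v(2) j v(1) g] \<mu>r[OF v(3) u(1) v(1)] g
            is_functor_into_opens_arr(1)[OF D, of "(j, v)"] is_functor_into_opens_arr(1)[OF D, of "(u, v)"] v
          by (simp add: Hom_opens_ring)
      qed
      show "\<exists>!h. h \<in> Hom (set_cat U) (FObj ?H c) Z \<and>
          (\<forall>j\<in>Obj ?J. Comp (set_cat U) h (FArr ?H (\<iota> j)) = \<mu> j)"
      proof (rule ex1I[of _ "\<mu> u"], intro conjI ballI)
        show "\<mu> u \<in> Hom (set_cat U) (FObj ?H c) Z" using \<mu>u Hc by simp
      next
        fix j assume "j \<in> Obj ?J"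
        then have j: "j \<in> A" by simp
        have hom: "FArr ?H (\<iota> j) \<in> Hom (set_cat U) (Hom T x (FObj D j)) (Hom T x c)"
        proof -
          have "FArr ?H (\<iota> j) \<in> Hom (set_cat U) (FObj (comp_func ?J ?H D) j) (FObj ?H c)"
            using co j Jsimp(1) unfolding cocone_def by blast
          then show ?thesis by (simp only: FH[OF j] Hc)
        qed
        show "Comp (set_cat U) (\<mu> u) (FArr ?H (\<iota> j)) = \<mu> j"
        proof (rule set_arrow_eqI[OF Comp_in_Hom[OF category_set_cat hom \<mu>u] \<mu>[OF j]])
          fix g assume g: "g \<in> Hom T x (FObj D j)"
          then show "under (Comp (set_cat U) (\<mu> u) (FArr ?H (\<iota> j))) g = under (\<mu> j) g"
            using \<mu>_const[OF j g] unfolding AH[OF j] by (simp add: \<iota>[OF j] Hom_opens_ring)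
        qed
      next
        fix h assume h: "h \<in> Hom (set_cat U) (FObj ?H c) Z \<and>
          (\<forall>j\<in>Obj ?J. Comp (set_cat U) h (FArr ?H (\<iota> j)) = \<mu> j)"
        then have h1: "h \<in> Hom (set_cat U) (Hom T x c) Z"
          and h2: "\<mu> u = Comp (set_cat U) h (FArr ?H (\<iota> u))" using Hc u(1) by auto
        show "h = \<mu> u"
        proof (rule set_arrow_eqI[OF h1 \<mu>u])
          fix g assume "g \<in> Hom T x c"
          then show "under h g = under (\<mu> u) g"
            unfolding h2 AH[OF u(1)] Du by (simp add: \<iota>[OF u(1)] Hom_opens_ring)
        qed
      qed
    qed
  qed
  then show ?thesis unfolding little_def using x K(1) by blast
qed

text \<open>
  A small poset with all joins is presentable, with all of its objects as generators.
\<close>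

lemma presentable_opens: "presentable U T"
proof -
  have "Obj T = colimit_closure U T (Obj T)"
  proof
    show "Obj T \<subseteq> colimit_closure U T (Obj T)" by (auto intro: colimit_closure.base)
    show "colimit_closure U T (Obj T) \<subseteq> Obj T"
    proof
      fix c assume "c \<in> colimit_closure U T (Obj T)"
      then show "c \<in> Obj T" by cases (auto simp: is_colimit_def cocone_def)
    qed
  qed
  moreover have "small U (Obj T)" using small_image[OF small_opens] by simp
  ultimately show ?thesis
    unfolding presentable_def
    using category_opens locally_small_opens cocomplete_opens little_opens by blast
qed

text \<open>
  Tensoring preserves colimits because intersection distributes over unions.
\<close>

lemma commutative_2ring_opens: "commutative_2ring U T"
  unfolding commutative_2ring_def
proof (intro conjI ballI presentable_opens symmetric_monoidal_opens)
  fix x assume x: "x \<in> Obj T"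
  let ?L = "\<lparr>FObj = (\<lambda>y\<in>Obj T. TensO T x y), FArr = (\<lambda>f\<in>Arr T. TensA T (Idt T x) f)\<rparr>"
  let ?R = "\<lparr>FObj = (\<lambda>y\<in>Obj T. TensO T y x), FArr = (\<lambda>f\<in>Arr T. TensA T f (Idt T x))\<rparr>"
  have L: "is_functor T T ?L" and R: "is_functor T T ?R"
    unfolding is_functor_def using x
    by (auto simp: Hom_opens_ring Arr_opens_ring Int_open) (blast+)
  have sub: "pts c \<subseteq> (\<Union>j\<in>Obj J. pts (FObj D j))" "c \<in> Obj T" "\<And>j. j \<in> Obj J \<Longrightarrow> FObj D j \<in> Obj T"
    if "category J" "is_functor J T D" "is_colimit J T D c \<iota>"
    for J :: "('u, 'u) cat" and D :: "('u, 'u, 'u gset, 'u gset_map) func" and c \<iota>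
    using that is_functorD(1)[OF that(2)] unfolding is_colimit_opens_iff[OF that(1,2)]
    by (auto simp: cocone_def)
  have pres: "preserves_colimit J D T T ?L" "preserves_colimit J D T T ?R"
    if J: "category J" and D: "is_functor J T D"
    for J :: "('u, 'u) cat" and D :: "('u, 'u, 'u gset, 'u gset_map) func"
  proof -
    have LR: "pts (FObj ?L y) = pts x \<inter> pts y" "pts (FObj ?R y) = pts y \<inter> pts x"
      if "y \<in> Obj T" for y
      using that by simp_all
    show "preserves_colimit J D T T ?L"
    proof (rule preserves_colimit_into_opens[OF J D L])
      fix c \<iota> assume c: "is_colimit J T D c \<iota>"
      show "pts (FObj ?L c) \<subseteq> (\<Union>j\<in>Obj J. pts (FObj ?L (FObj D j)))"
        using sub(1)[OF J D c] LR(1)[OF sub(2)[OF J D c]] LR(1)[OF sub(3)[OF J D c]] by auto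
    qed
    show "preserves_colimit J D T T ?R"
    proof (rule preserves_colimit_into_opens[OF J D R])
      fix c \<iota> assume c: "is_colimit J T D c \<iota>"
      show "pts (FObj ?R c) \<subseteq> (\<Union>j\<in>Obj J. pts (FObj ?R (FObj D j)))"
        using sub(1)[OF J D c] LR(2)[OF sub(2)[OF J D c]] LR(2)[OF sub(3)[OF J D c]] by auto
    qed
  qed
  show "cocontinuous U T T ?L"
    unfolding cocontinuous_def small_category_def
    by (intro allI impI, elim conjE) (rule pres(1); assumption)
  show "cocontinuous U T T ?R"
    unfolding cocontinuous_def small_category_def
    by (intro allI impI, elim conjE) (rule pres(2); assumption)
qed

end

section \<open>The support of a family as a ring morphism\<close>

text \<open>
  For a map \<open>p\<close> from the space to \<open>X\<close>, the set of points over whose image a family on \<open>X\<close> is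
  nonempty. If \<open>p\<close> has open fibres, this is the action on objects of the ring morphism to the
  frame of open sets given by the partition of the space into the fibres of \<open>p\<close>.
\<close>

definition support :: "'u set set \<Rightarrow> ('u \<Rightarrow> 'u) \<Rightarrow> 'u gset \<Rightarrow> 'u gset" where
  "support \<O> p F = code {e \<in> \<Union>\<O>. FObj F (p e) \<noteq> {}}"

text \<open>
  The support of a product is equal to the intersection of the supports, and not only isomorphic to
  it, so the monoidal structure consists of identities.
\<close>

definition support_functor ::
  "'u itself \<Rightarrow> 'u set set \<Rightarrow> 'u set \<Rightarrow> ('u \<Rightarrow> 'u) \<Rightarrow> ('u gset, 'u gset_map) ring_func" where
  "support_functor U \<O> X p =
     (let R = GSet U (disc X); S = support \<O> p in
      \<lparr>FObj = (\<lambda>F\<in>Obj R. S F),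
       FArr = (\<lambda>\<alpha>\<in>Arr R. Arrow (S (source \<alpha>)) (S (target \<alpha>)) undefined),
       MuF = (\<lambda>(F, H)\<in>Obj R \<times> Obj R. Arrow (S (TensO R F H)) (S (TensO R F H)) undefined),
       EpsF = Arrow (code (\<Union>\<O>)) (code (\<Union>\<O>)) undefined\<rparr>)"

context small_topology
begin

text \<open>
  The support is a union of fibres, hence open. It is monoidal because a product of two sets is
  nonempty iff both factors are, and cocontinuous by \<open>GSet_disc_colimit_covers\<close>. All coherence
  conditions hold because parallel arrows of a poset are equal.
\<close>

lemma support_functor_in_com2ring_hom:
  assumes p: "\<And>e. e \<in> \<Union>\<O> \<Longrightarrow> p e \<in> X"
    and fib: "\<And>t. t \<in> X \<Longrightarrow> {e \<in> \<Union>\<O>. p e = t} \<in> \<O>"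
  shows "support_functor U \<O> X p \<in> Obj (com2ring_hom U (GSet U (disc X)) T)"
proof -
  let ?R = "GSet U (disc X)" and ?S = "support \<O> p"
  define \<Phi> where "\<Phi> = support_functor U \<O> X p"
  have R: "category ?R" by (rule category_GSet[OF category_disc])
  have top: "\<Union>\<O> \<in> \<O>" by (rule Union_open) simp
  have S_open: "?S F \<in> code ` \<O>" if "F \<in> Obj ?R" for F
  proof -
    have "{e \<in> \<Union>\<O>. FObj F (p e) \<noteq> {}} = \<Union>((\<lambda>t. {e \<in> \<Union>\<O>. p e = t}) ` {t\<in>X. FObj F t \<noteq> {}})"
      using p by auto
    also have "\<dots> \<in> \<O>" by (rule Union_open) (use fib in auto)
    finally show ?thesis by (simp add: support_def)
  qed
  have S_mono: "pts (?S F) \<subseteq> pts (?S H)" if "\<alpha> \<in> Hom ?R F H" for \<alpha> F H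
    using that p by (fastforce simp: support_def Hom_GSet_disc Hom_set_cat)
  have S_tensor: "?S (TensO ?R F H) = code (pts (?S F) \<inter> pts (?S H))" for F H
  proof -
    have "FObj (TensO ?R F H) (p e) \<noteq> {} \<longleftrightarrow> FObj F (p e) \<noteq> {} \<and> FObj H (p e) \<noteq> {}"
      if "e \<in> \<Union>\<O>" for e
      using p[OF that] by (simp add: FObj_tensor_func_disc utimes_def)
    then show ?thesis unfolding support_def by (auto intro!: arg_cong[of _ _ code] simp del: Union_iff)
  qed
  have S_unit: "?S (Unit ?R) = code (\<Union>\<O>)"
  proof -
    have "FObj (Unit ?R) (p e) \<noteq> {}" if "e \<in> \<Union>\<O>" for e
      using p[OF that] by (simp add: unit_func_def upoint_def)
    then show ?thesis unfolding support_def by (auto simp del: Union_iff)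
  qed
  have FObj': "FObj \<Phi> F = ?S F" if "F \<in> Obj ?R" for F
    using that by (simp add: \<Phi>_def support_functor_def Let_def)
  have FArr': "FArr \<Phi> \<alpha> = Arrow (?S F) (?S H) undefined" if "\<alpha> \<in> Hom ?R F H" for \<alpha> F H
    using that by (auto simp: \<Phi>_def support_functor_def Let_def Hom_def)
  have MuF': "MuF \<Phi> (F, H) = Arrow (?S (TensO ?R F H)) (?S (TensO ?R F H)) undefined"
    if "F \<in> Obj ?R" "H \<in> Obj ?R" for F H
    using that by (simp add: \<Phi>_def support_functor_def Let_def)
  have EpsF': "EpsF \<Phi> = Arrow (code (\<Union>\<O>)) (code (\<Union>\<O>)) undefined"
    by (simp add: \<Phi>_def support_functor_def Let_def)
  have arr: "\<alpha> \<in> Hom ?R (Dom ?R \<alpha>) (Cod ?R \<alpha>)" if "\<alpha> \<in> Arr ?R" for \<alpha>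
    using that by (simp add: Hom_def)
  note DomO = Dom_in_Obj[OF R] and CodO = Cod_in_Obj[OF R]
  note TO = GSet_TensO_in_Obj[OF inacc] and UO = GSet_Unit_in_Obj[OF inacc]
  have is_func: "is_functor ?R T \<Phi>"
    unfolding is_functor_def
  proof (intro conjI ballI impI)
    show "FObj \<Phi> \<in> Obj ?R \<rightarrow>\<^sub>E Obj T"
      using S_open by (auto simp: \<Phi>_def support_functor_def Let_def)
    show "FArr \<Phi> \<in> extensional (Arr ?R)"
      by (auto simp: \<Phi>_def support_functor_def Let_def)
  next
    fix \<alpha> assume \<alpha>: "\<alpha> \<in> Arr ?R"
    show "FArr \<Phi> \<alpha> \<in> Hom T (FObj \<Phi> (Dom ?R \<alpha>)) (FObj \<Phi> (Cod ?R \<alpha>))"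
      unfolding FArr'[OF arr[OF \<alpha>]] FObj'[OF DomO[OF \<alpha>]] FObj'[OF CodO[OF \<alpha>]]
      using S_open DomO[OF \<alpha>] CodO[OF \<alpha>] S_mono[OF arr[OF \<alpha>]] by (simp add: Hom_opens_ring)
  next
    fix F assume F: "F \<in> Obj ?R"
    show "FArr \<Phi> (Idt ?R F) = Idt T (FObj \<Phi> F)"
      unfolding FArr'[OF Idt_in_Hom[OF R F]] FObj'[OF F] by simp
  next
    fix \<alpha> \<beta> assume \<alpha>: "\<alpha> \<in> Arr ?R" and \<beta>: "\<beta> \<in> Arr ?R" and eq: "Cod ?R \<alpha> = Dom ?R \<beta>"
    have \<beta>': "\<beta> \<in> Hom ?R (Cod ?R \<alpha>) (Cod ?R \<beta>)" using arr[OF \<beta>] eq by simp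
    show "FArr \<Phi> (Comp ?R \<beta> \<alpha>) = Comp T (FArr \<Phi> \<beta>) (FArr \<Phi> \<alpha>)"
      unfolding FArr'[OF Comp_in_Hom[OF R arr[OF \<alpha>] \<beta>']] FArr'[OF \<beta>'] FArr'[OF arr[OF \<alpha>]] by simp
  qed
  have iso: "is_iso T (Arrow a a undefined)" if "a \<in> Obj T" for a
    using Idt_is_iso[OF category_opens that] by simp
  have "symmetric_monoidal_functor ?R T \<Phi>"
    unfolding symmetric_monoidal_functor_def
  proof (intro conjI ballI is_func)
    show "MuF \<Phi> \<in> extensional (Obj ?R \<times> Obj ?R)"
      by (auto simp: \<Phi>_def support_functor_def Let_def)
    show "is_iso T (EpsF \<Phi>)" unfolding EpsF' by (rule iso) (simp add: top)
    show "EpsF \<Phi> \<in> Hom T (Unit T) (FObj \<Phi> (Unit ?R))"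
      unfolding EpsF' FObj'[OF UO] S_unit using top by (simp add: Hom_opens_ring)
  next
    fix F H assume F: "F \<in> Obj ?R" and H: "H \<in> Obj ?R"
    show "is_iso T (MuF \<Phi> (F, H))"
      unfolding MuF'[OF F H] by (rule iso) (use S_open[OF TO[OF F H]] in simp)
    show "MuF \<Phi> (F, H) \<in> Hom T (TensO T (FObj \<Phi> F) (FObj \<Phi> H)) (FObj \<Phi> (TensO ?R F H))"
      unfolding MuF'[OF F H] FObj'[OF F] FObj'[OF H] FObj'[OF TO[OF F H]]
      using S_open[OF TO[OF F H]] unfolding S_tensor by (simp add: Hom_opens_ring)
    show "Comp T (FArr \<Phi> (Braid ?R F H)) (MuF \<Phi> (F, H))
        = Comp T (MuF \<Phi> (H, F)) (Braid T (FObj \<Phi> F) (FObj \<Phi> H))"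
      unfolding FArr'[OF GSet_Braid_in_Hom[OF inacc F H]] MuF'[OF F H] MuF'[OF H F] FObj'[OF F] FObj'[OF H]
      unfolding S_tensor by simp
  next
    fix \<alpha> \<beta> assume \<alpha>: "\<alpha> \<in> Arr ?R" and \<beta>: "\<beta> \<in> Arr ?R"
    show "Comp T (MuF \<Phi> (Cod ?R \<alpha>, Cod ?R \<beta>)) (TensA T (FArr \<Phi> \<alpha>) (FArr \<Phi> \<beta>))
        = Comp T (FArr \<Phi> (TensA ?R \<alpha> \<beta>)) (MuF \<Phi> (Dom ?R \<alpha>, Dom ?R \<beta>))"
      unfolding MuF'[OF CodO[OF \<alpha>] CodO[OF \<beta>]] MuF'[OF DomO[OF \<alpha>] DomO[OF \<beta>]]
        FArr'[OF arr[OF \<alpha>]] FArr'[OF arr[OF \<beta>]]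
        FArr'[OF GSet_TensA_in_Hom[OF inacc arr[OF \<alpha>] arr[OF \<beta>]]]
      unfolding S_tensor by simp
  next
    fix F H K assume F: "F \<in> Obj ?R" and H: "H \<in> Obj ?R" and K: "K \<in> Obj ?R"
    show "Comp T (FArr \<Phi> (Assoc ?R F H K))
          (Comp T (MuF \<Phi> (TensO ?R F H, K)) (TensA T (MuF \<Phi> (F, H)) (Idt T (FObj \<Phi> K)))) =
        Comp T (MuF \<Phi> (F, TensO ?R H K))
          (Comp T (TensA T (Idt T (FObj \<Phi> F)) (MuF \<Phi> (H, K)))
            (Assoc T (FObj \<Phi> F) (FObj \<Phi> H) (FObj \<Phi> K)))"
      unfolding FArr'[OF GSet_Assoc_in_Hom[OF inacc F H K]] MuF'[OF F H] MuF'[OF H K]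
        MuF'[OF TO[OF F H] K] MuF'[OF F TO[OF H K]] FObj'[OF F] FObj'[OF H] FObj'[OF K]
      unfolding S_tensor by (simp add: Int_assoc)
  next
    fix F assume F: "F \<in> Obj ?R"
    show "Comp T (FArr \<Phi> (LUnit ?R F))
          (Comp T (MuF \<Phi> (Unit ?R, F)) (TensA T (EpsF \<Phi>) (Idt T (FObj \<Phi> F)))) =
        LUnit T (FObj \<Phi> F)"
      unfolding FArr'[OF GSet_LUnit_in_Hom[OF inacc F]] MuF'[OF UO F] FObj'[OF F] EpsF' by simp
    show "Comp T (FArr \<Phi> (RUnit ?R F))
          (Comp T (MuF \<Phi> (F, Unit ?R)) (TensA T (Idt T (FObj \<Phi> F)) (EpsF \<Phi>))) =
        RUnit T (FObj \<Phi> F)"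
      unfolding FArr'[OF GSet_RUnit_in_Hom[OF inacc F]] MuF'[OF F UO] FObj'[OF F] EpsF' by simp
  qed
  moreover have "cocontinuous U ?R T \<Phi>"
    unfolding cocontinuous_def
  proof (intro allI impI)
    fix J :: "('u, 'u) cat" and D
    assume "small_category U J \<and> is_functor J ?R D"
    then have J: "category J" and D: "is_functor J ?R D" by (auto simp: small_category_def)
    show "preserves_colimit J D ?R T \<Phi>"
    proof (rule preserves_colimit_into_opens[OF J D is_func])
      fix c \<iota> assume c: "is_colimit J ?R D c \<iota>"
      then have cO: "c \<in> Obj ?R" by (simp add: is_colimit_def cocone_def)
      have Dj: "FObj \<Phi> (FObj D j) = ?S (FObj D j)" if "j \<in> Obj J" for j
        by (rule FObj'[OF is_functorD(1)[OF D that]])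
      show "pts (FObj \<Phi> c) \<subseteq> (\<Union>j\<in>Obj J. pts (FObj \<Phi> (FObj D j)))"
      proof
        fix e assume "e \<in> pts (FObj \<Phi> c)"
        then obtain y where e: "e \<in> \<Union>\<O>" and y: "y \<in> FObj c (p e)"
          unfolding FObj'[OF cO] by (auto simp: support_def)
        obtain j where "j \<in> Obj J" "FObj (FObj D j) (p e) \<noteq> {}"
          using GSet_disc_colimit_covers[OF inacc J D c p[OF e] y] by blast
        then show "e \<in> (\<Union>j\<in>Obj J. pts (FObj \<Phi> (FObj D j)))"
          using e Dj by (auto simp: support_def)
      qed
    qed
  qed
  ultimately show ?thesis
    unfolding com2ring_hom_def \<Phi>_def Let_def by simp
qed

end

section \<open>Failure of the universal property\<close>

context small_topology
begin

text \<open>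
  A ring morphism \<open>f\<close> out of families indexed by the points that induces the supports along all
  \<open>p i\<close> would decompose the space into open sets \<open>f (\<delta> e) \<subseteq> {e}\<close>, because the \<open>p i\<close> separate
  points. Without isolated points all of them are empty, and so is their union, the whole space.
\<close>

lemma GSet_product_not_preserved:
  assumes p: "\<And>i e. i \<in> I \<Longrightarrow> e \<in> \<Union>\<O> \<Longrightarrow> p i e \<in> X i"
    and fib: "\<And>i t. i \<in> I \<Longrightarrow> t \<in> X i \<Longrightarrow> {e \<in> \<Union>\<O>. p i e = t} \<in> \<O>"
    and sep: "\<And>e e'. e \<in> \<Union>\<O> \<Longrightarrow> e' \<in> \<Union>\<O> \<Longrightarrow> (\<And>i. i \<in> I \<Longrightarrow> p i e = p i e') \<Longrightarrow> e = e'"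
    and no_isolated: "\<And>e. e \<in> \<Union>\<O> \<Longrightarrow> {e} \<notin> \<O>"
    and nonempty: "\<Union>\<O> \<noteq> {}" and small: "small U (\<Union>\<O>)"
  shows "\<not> universal_cone (TwoAfSch U) I (\<lambda>i. GSet U (disc (X i))) (GSet U (disc (\<Union>\<O>)))
    (\<lambda>i. pullback U (disc (\<Union>\<O>)) (disc (X i)) (disc_map (\<Union>\<O>) (p i)))"
proof
  let ?E = "\<Union>\<O>"
  let ?P = "GSet U (disc ?E)" and ?A = "\<lambda>i. GSet U (disc (X i))"
  let ?\<pi> = "\<lambda>i. pullback U (disc ?E) (disc (X i)) (disc_map ?E (p i))"
  let ?C = "com2ring_hom U ?P T" and ?D = "prod_cat I (\<lambda>i. com2ring_hom U (?A i) T)"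
  let ?F = "comparison (TwoAfSch U) I ?A ?P ?\<pi> T"
  assume "universal_cone (TwoAfSch U) I ?A ?P ?\<pi>"
  moreover have "T \<in> Ob (TwoAfSch U)"
    using commutative_2ring_opens by (simp add: TwoAfSch_def one_op_def Com2Ring_def)
  ultimately have "is_equivalence ?C ?D ?F"
    unfolding universal_cone_def by (simp add: TwoAfSch_def one_op_def Com2Ring_def)
  then obtain G :: "(_, _, _, _) func" where G: "is_functor ?D ?C G" and iso: "nat_isomorphic ?D ?D (comp_func ?D ?F G) (id_func ?D)"
    unfolding is_equivalence_def by blast
  then obtain \<eta> where \<eta>: "nat_trans ?D ?D (comp_func ?D ?F G) (id_func ?D) \<eta>"
    unfolding nat_isomorphic_def by blast
  \<comment> \<open>An inverse of the comparison functor turns the supports \<open>\<phi>\<close> into one morphism \<open>f\<close>.\<close>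
  define \<phi> where "\<phi> = (\<lambda>i\<in>I. support_functor U \<O> (X i) (p i))"
  have \<phi>: "\<phi> \<in> Obj ?D"
    using support_functor_in_com2ring_hom p fib by (auto simp: \<phi>_def)
  define f where "f = FObj G \<phi>"
  have f: "f \<in> Obj ?C" unfolding f_def by (rule is_functorD(1)[OF G \<phi>])
  then have fm: "symmetric_monoidal_functor ?P T f" and fc: "cocontinuous U ?P T f"
    by (auto simp: com2ring_hom_def Let_def)
  then have ff: "is_functor ?P T f" by (simp add: symmetric_monoidal_functor_def)
  have Ff: "FObj ?F f i = comp_monfunc (?A i) T f (?\<pi> i)" if "i \<in> I" for i
    using f that by (simp add: comparison_def TwoAfSch_def one_op_def Com2Ring_def)
  \<comment> \<open>Of the isomorphism between the restrictions of \<open>f\<close> and \<open>\<phi>\<close>, one direction suffices.\<close>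
  have below: "pts (FObj f (comp_func (disc ?E) H (disc_map ?E (p i)))) \<subseteq> {e \<in> ?E. FObj H (p i e) \<noteq> {}}"
    if i: "i \<in> I" and H: "H \<in> Obj (?A i)" for i H
  proof -
    have "\<eta> \<phi> \<in> Hom ?D (FObj ?F f) \<phi>"
      using nat_transD(2)[OF \<eta> \<phi>] \<phi> by (simp add: comp_func_def compose_def id_func_def f_def)
    then have "\<eta> \<phi> i \<in> Hom (com2ring_hom U (?A i) T) (FObj ?F f i) (\<phi> i)"
      by (rule Hom_prod_cat) (rule i)
    then have "nat_trans (?A i) T (FObj ?F f i) (\<phi> i) (under (\<eta> \<phi> i))"
      by (auto simp: Hom_def com2ring_hom_def Let_def monoidal_trans_def)
    then have "under (\<eta> \<phi> i) H \<in> Hom T (FObj (FObj ?F f i) H) (FObj (\<phi> i) H)"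
      by (rule nat_transD(2)) (rule H)
    then have "pts (FObj (FObj ?F f i) H) \<subseteq> pts (FObj (\<phi> i) H)"
      by (simp add: Hom_opens_ring)
    moreover have "FObj (FObj ?F f i) H = FObj f (comp_func (disc ?E) H (disc_map ?E (p i)))"
      unfolding Ff[OF i] using H by (simp add: comp_monfunc_def compose_def pullback_def)
    moreover have "pts (FObj (\<phi> i) H) = {e \<in> ?E. FObj H (p i e) \<noteq> {}}"
      using H i by (simp add: \<phi>_def support_functor_def support_def)
    ultimately show ?thesis by (simp only:)
  qed
  have f_point: "pts (FObj f (point_at ?E e)) = {}" if e: "e \<in> ?E" for e
  proof -
    have le: "p i e' = p i e" if i: "i \<in> I" and e': "e' \<in> pts (FObj f (point_at ?E e))" for i e'
    proof -
      let ?H = "point_at (X i) (p i e)"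
      let ?K = "comp_func (disc ?E) ?H (disc_map ?E (p i))"
      have H: "?H \<in> Obj (?A i)" using is_functor_point_at[OF inacc] by simp
      have "is_functor (disc ?E) (disc (X i)) (disc_map ?E (p i))"
        using p i by (intro is_functor_disc_map) auto
      then have K: "is_functor (disc ?E) (Set_moncat U) ?K"
        using is_functor_comp_func[OF category_disc] is_functor_point_at[OF inacc] by blast
      have Kx: "FObj ?K x = (if p i x = p i e then upoint else {})" if "x \<in> ?E" for x
        using p[OF i that] that by (simp add: comp_func_def compose_def)
      have "Arrow (point_at ?E e) ?K (\<lambda>x\<in>?E. set_map (FObj (point_at ?E e) x) (FObj ?K x) (\<lambda>y. y))
          \<in> Hom ?P (point_at ?E e) ?K"
        unfolding Hom_GSet_disc using is_functor_point_at[OF inacc] K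
        by (auto simp: Kx small_upoint[OF inacc] small_finite[OF inacc] simp del: Union_iff intro!: set_map_in_Hom)
      then have "pts (FObj f (point_at ?E e)) \<subseteq> pts (FObj f ?K)"
        using is_functorD(2)[OF ff] by (fastforce simp: Hom_opens_ring)
      also have "\<dots> \<subseteq> {e' \<in> ?E. FObj ?H (p i e') \<noteq> {}}" by (rule below[OF i H])
      finally have "e' \<in> ?E" "FObj ?H (p i e') \<noteq> {}" using e' by blast+
      then show ?thesis using p[OF i] by (simp split: if_splits del: Union_iff)
    qed
    have fO: "pts (FObj f (point_at ?E e)) \<in> \<O>"
      using is_functorD(1)[OF ff, of "point_at ?E e"] is_functor_point_at[OF inacc] by auto
    have "pts (FObj f (point_at ?E e)) \<subseteq> {e}"
    proof
      fix e' assume e': "e' \<in> pts (FObj f (point_at ?E e))"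
      then have "e' \<in> ?E" using fO by blast
      then show "e' \<in> {e}" using sep[OF _ e le[OF _ e']] by blast
    qed
    then show ?thesis using fO no_isolated[OF e] by (metis subset_singletonD)
  qed
  obtain \<iota> where "is_colimit (disc ?E) ?P (points_diagram U ?E) (Unit ?P) \<iota>"
    using unit_is_colimit_of_points[OF inacc] by blast
  moreover have "small_category U (disc ?E)" using small by (simp add: small_category_def category_disc)
  ultimately have "is_colimit (disc ?E) T (comp_func (disc ?E) f (points_diagram U ?E)) (FObj f (Unit ?P))
      (\<lambda>j. FArr f (\<iota> j))"
    using fc is_functor_points_diagram[OF inacc] unfolding cocontinuous_def preserves_colimit_def by blast
  then have "pts (FObj f (Unit ?P)) = (\<Union>e\<in>?E. pts (FObj (comp_func (disc ?E) f (points_diagram U ?E)) e))"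
    using is_colimit_opens_iff[OF category_disc
        is_functor_comp_func[OF category_disc is_functor_points_diagram[OF inacc] ff]] by simp
  also have "\<dots> = {}"
    using f_point by (auto simp: comp_func_def compose_def points_diagram_def)
  finally have "pts (FObj f (Unit ?P)) = {}" .
  moreover have "EpsF f \<in> Hom T (Unit T) (FObj f (Unit ?P))"
    using fm by (simp add: symmetric_monoidal_functor_def)
  then have "?E \<subseteq> pts (FObj f (Unit ?P))" by (simp add: Hom_opens_ring)
  ultimately show False using nonempty by simp
qed

end

section \<open>Cantor space inside the universe\<close>

text \<open>
  A point of Cantor space is a subset of \<open>I\<close>, coded as an element of the universe, and a set is open
  if it contains, with each point, all points that agree with it on some finite set of coordinates.
  There are no isolated points because \<open>I\<close> is infinite.
\<close>

lemma coded_Cantor_space: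
  fixes I :: "'u set" and a b :: 'u
  assumes inacc: "inaccessible (U :: 'u itself)" and I: "infinite I" "small U I" and ab: "a \<noteq> b"
  obtains E :: "'u set" and p :: "'u \<Rightarrow> 'u \<Rightarrow> 'u" and \<O> :: "'u set set"
  where "small U E" "E \<noteq> {}" "bij_betw (\<lambda>e. \<lambda>i\<in>I. p i e) E (\<Pi>\<^sub>E i\<in>I. {a, b})"
    and "small_topology U \<O>" "\<Union>\<O> = E"
    and "\<And>i t. i \<in> I \<Longrightarrow> {e \<in> E. p i e = t} \<in> \<O>" "\<And>e. e \<in> E \<Longrightarrow> {e} \<notin> \<O>"
proof -
  note small_Pow = small_Pow[OF inacc]
  obtain c :: "'u set \<Rightarrow> 'u" where c: "inj_on c (Pow I)" using small_copy[OF small_Pow[OF I(2)]] .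
  define E where "E = c ` Pow I"
  define dec where "dec = inv_into (Pow I) c"
  have dec: "dec (c M) = M" if "M \<subseteq> I" for M using c that by (simp add: dec_def)
  define p where "p i e = (if i \<in> dec e then a else b)" for i e
  define cyl where "cyl e F = {e' \<in> E. \<forall>i\<in>F. p i e' = p i e}" for e F
  define \<O> where "\<O> = {V. V \<subseteq> E \<and> (\<forall>e\<in>V. \<exists>F. finite F \<and> F \<subseteq> I \<and> cyl e F \<subseteq> V)}"
  have EO: "\<Union>\<O> = E"
  proof
    show "\<Union>\<O> \<subseteq> E" by (auto simp: \<O>_def)
    have "E \<in> \<O>" by (auto simp: \<O>_def cyl_def intro!: exI[of _ "{}"])
    then show "E \<subseteq> \<Union>\<O>" by blast
  qed
  have open_cyl: "\<exists>F. finite F \<and> F \<subseteq> I \<and> cyl e F \<subseteq> V" if "V \<in> \<O>" "e \<in> V" for V e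
    using that by (auto simp: \<O>_def)
  have E: "small U E" unfolding E_def by (rule small_image[OF small_Pow[OF I(2)]])
  have topology: "small_topology U \<O>"
  proof
    show "inaccessible U" by (rule inacc)
    show "small U \<O>" by (rule small_subset[OF _ small_Pow[OF E]]) (auto simp: \<O>_def)
  next
    fix S assume S: "S \<subseteq> \<O>"
    show "\<Union>S \<in> \<O>"
      unfolding \<O>_def
    proof (intro CollectI conjI ballI)
      show "\<Union>S \<subseteq> E" using S by (auto simp: \<O>_def)
      fix e assume "e \<in> \<Union>S"
      then obtain V where V: "V \<in> S" "e \<in> V" by blast
      then obtain F where "finite F" "F \<subseteq> I" "cyl e F \<subseteq> V"
        using open_cyl[OF subsetD[OF S V(1)] V(2)] by blast
      then show "\<exists>F. finite F \<and> F \<subseteq> I \<and> cyl e F \<subseteq> \<Union>S" using V(1) by blast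
    qed
  next
    fix V W assume V: "V \<in> \<O>" and W: "W \<in> \<O>"
    show "V \<inter> W \<in> \<O>"
      unfolding \<O>_def
    proof (intro CollectI conjI ballI)
      show "V \<inter> W \<subseteq> E" using V by (auto simp: \<O>_def)
      fix e assume "e \<in> V \<inter> W"
      then have e: "e \<in> V" "e \<in> W" by auto
      obtain F where F: "finite F" "F \<subseteq> I" "cyl e F \<subseteq> V" using open_cyl[OF V e(1)] by blast
      obtain F' where F': "finite F'" "F' \<subseteq> I" "cyl e F' \<subseteq> W" using open_cyl[OF W e(2)] by blast
      have "cyl e (F \<union> F') \<subseteq> cyl e F" "cyl e (F \<union> F') \<subseteq> cyl e F'" by (auto simp: cyl_def)
      with F F' show "\<exists>F. finite F \<and> F \<subseteq> I \<and> cyl e F \<subseteq> V \<inter> W"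
        by (intro exI[of _ "F \<union> F'"]) auto
    qed
  qed
  have dec_eq: "i \<in> dec e \<longleftrightarrow> p i e = a" for i e using ab by (simp add: p_def)
  have sep: "e = e'" if e: "e \<in> E" "e' \<in> E" and eq: "\<And>i. i \<in> I \<Longrightarrow> p i e = p i e'" for e e'
  proof -
    obtain M M' where M: "M \<subseteq> I" "e = c M" "M' \<subseteq> I" "e' = c M'" using e by (auto simp: E_def)
    then have "i \<in> M \<longleftrightarrow> i \<in> M'" if "i \<in> I" for i
      using dec_eq[of i e] dec_eq[of i e'] eq[OF that] dec by simp
    then have "M = M'" using M by blast
    then show ?thesis using M by simp
  qed
  have bij: "bij_betw (\<lambda>e. \<lambda>i\<in>I. p i e) E (\<Pi>\<^sub>E i\<in>I. {a, b})"
  proof (rule bij_betw_imageI)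
    show "inj_on (\<lambda>e. \<lambda>i\<in>I. p i e) E"
      by (rule inj_onI) (metis sep restrict_apply')
    show "(\<lambda>e. \<lambda>i\<in>I. p i e) ` E = (\<Pi>\<^sub>E i\<in>I. {a, b})"
    proof
      show "(\<lambda>e. \<lambda>i\<in>I. p i e) ` E \<subseteq> (\<Pi>\<^sub>E i\<in>I. {a, b})" by (auto simp: p_def)
      show "(\<Pi>\<^sub>E i\<in>I. {a, b}) \<subseteq> (\<lambda>e. \<lambda>i\<in>I. p i e) ` E"
      proof
        fix x assume x: "x \<in> (\<Pi>\<^sub>E i\<in>I. {a, b})"
        let ?e = "c {i\<in>I. x i = a}"
        have "dec ?e = {i\<in>I. x i = a}" by (rule dec) auto
        then have "x = (\<lambda>i\<in>I. p i ?e)"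
          using x by (intro extensionalityI[of _ I]) (auto simp: p_def PiE_iff)
        moreover have "?e \<in> E" by (auto simp: E_def)
        ultimately show "x \<in> (\<lambda>e. \<lambda>i\<in>I. p i e) ` E" by blast
      qed
    qed
  qed
  have fibres: "{e \<in> E. p i e = t} \<in> \<O>" if "i \<in> I" for i t
    using that by (auto simp: \<O>_def cyl_def intro!: exI[of _ "{i}"])
  have no_isolated: "{e} \<notin> \<O>" if e: "e \<in> E" for e
  proof
    assume "{e} \<in> \<O>"
    then obtain F where F: "finite F" "F \<subseteq> I" "cyl e F \<subseteq> {e}"
      using open_cyl[of "{e}" e] by blast
    obtain i where i: "i \<in> I" "i \<notin> F" using I(1) F(1) by (meson finite_subset subsetI)
    obtain M where M: "M \<subseteq> I" "e = c M" using e by (auto simp: E_def)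
    \<comment> \<open>Changing the coordinate \<open>i\<close> of \<open>e\<close> stays inside the cylinder, as \<open>F\<close> does not see \<open>i\<close>.\<close>
    define M' where "M' = (if i \<in> M then M - {i} else insert i M)"
    have M': "M' \<subseteq> I" "M' \<noteq> M" using M i by (auto simp: M'_def)
    have "c M' \<in> cyl e F"
      using M M'(1) i(2) by (auto simp: cyl_def E_def p_def dec M'_def)
    then have "c M' = c M" using F(3) M(2) by auto
    then show False using c M M' by (auto simp: inj_on_def)
  qed
  have "E \<noteq> {}" by (auto simp: E_def)
  then show ?thesis
    by (rule that[OF E _ bij topology EO fibres no_isolated])
qed

theorem lemma4p2p2:
  assumes "inaccessible TYPE('u)"
  shows "\<not> preserves_infinite_products TYPE('u) (Gpd TYPE('u)) (TwoAfSch TYPE('u)) (TwoSpecSet TYPE('u))"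
proof
  let ?U = "TYPE('u)"
  assume pres: "preserves_infinite_products ?U (Gpd ?U) (TwoAfSch ?U) (TwoSpecSet ?U)"
  obtain g :: "nat \<Rightarrow> 'u" where "inj g"
    using infinite_universe[OF assms] unfolding infinite_iff_countable_subset by blast
  define I where "I = range g"
  have I: "infinite I" "small ?U I"
    using \<open>inj g\<close> small_countable[OF assms] by (auto simp: I_def range_inj_infinite)
  obtain a b :: 'u where ab: "a \<noteq> b" using two_elements[OF assms] .
  show False
  proof (rule coded_Cantor_space[OF assms I ab])
    fix E p \<O>
    assume E: "small ?U E" "E \<noteq> {}"
      and bij: "bij_betw (\<lambda>e. \<lambda>i\<in>I. p i e) E (\<Pi>\<^sub>E i\<in>I. {a, b})"
      and top: "small_topology ?U \<O>" and EO: "\<Union>\<O> = E"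
      and fibres: "\<And>i t. i \<in> I \<Longrightarrow> {e \<in> E. p i e = t} \<in> \<O>"
      and no_isolated: "\<And>e. e \<in> E \<Longrightarrow> {e} \<notin> \<O>"
    have "is_product (Gpd ?U) I (\<lambda>i. disc {a, b}) (disc E) (\<lambda>i. disc_map E (p i))"
      by (rule is_product_disc[OF E(1) _ bij]) (simp add: small_finite[OF assms])
    then have "universal_cone (TwoAfSch ?U) I (\<lambda>i. GSet ?U (disc {a, b})) (GSet ?U (disc E))
        (\<lambda>i. pullback ?U (disc E) (disc {a, b}) (disc_map E (p i)))"
      using pres I unfolding preserves_infinite_products_def TwoSpecSet_def by auto
    moreover have "\<not> universal_cone (TwoAfSch ?U) I (\<lambda>i. GSet ?U (disc {a, b})) (GSet ?U (disc (\<Union>\<O>)))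
        (\<lambda>i. pullback ?U (disc (\<Union>\<O>)) (disc {a, b}) (disc_map (\<Union>\<O>) (p i)))"
    proof (rule small_topology.GSet_product_not_preserved[OF top], unfold EO)
      show "p i e \<in> {a, b}" if "i \<in> I" "e \<in> E" for i e
        using bij_betw_apply[OF bij that(2)] that(1) by (auto simp: PiE_iff)
      show "e = e'" if e: "e \<in> E" "e' \<in> E" and eq: "\<And>i. i \<in> I \<Longrightarrow> p i e = p i e'" for e e'
      proof -
        have "(\<lambda>i\<in>I. p i e) = (\<lambda>i\<in>I. p i e')" by (rule restrict_ext) (rule eq)
        then show ?thesis using e bij by (auto simp: bij_betw_def inj_on_def)
      qed
    qed (use E fibres no_isolated in auto)
    ultimately show False unfolding EO by blast
  qed
qed

end
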